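(* There is no nontrivially unstable graph pair $(\Gamma,\Sigma)$, where $\Gamma$ is non-bipartite and $\Sigma$ is bipartite, such that there is a $\Sigma$-mixer of $\Gamma\times\Sigma$ and $\Gamma$ is factor-loopless.
   Context: Graphs are finite and undirected, without multiple edges; loops are allowed. The direct product $\Gamma\times\Sigma$ has vertex set $V(\Gamma)\times V(\Sigma)$, with $(u,v)$ adjacent to $(x,y)$ if and only if $u$ is adjacent to $x$ in $\Gamma$ and $v$ is adjacent to $y$ in $\Sigma$. The pair $(\Gamma,\Sigma)$ is stable if $\mathrm{Aut}(\Gamma\times\Sigma)=\mathrm{Aut}(\Gamma)\times\mathrm{Aut}(\Sigma)$ (acting componentwise), and unstable otherwise. A graph is twin-free if no two distinct vertices have the same neighbourhood. Graphs $\Gamma,\Sigma$ are coprime if there is no graph $\Delta$ of order greater than $1$ such that $\Gamma\cong\Gamma'\times\Delta$ and $\Sigma\cong\Sigma'\times\Delta$ for some graphs $\Gamma',\Sigma'$ (loops allowed in $\Delta,\Gamma',\Sigma'$). A graph pair is nontrivial if its members are coprime connected twin-free graphs and exactly one of them is bipartite; it is nontrivially unstable if it is nontrivial and unstable. The bipartite member of a nontrivial pair has two nonempty partite sets. The $\Sigma$-partition of $V(\Gamma\times\Sigma)$ is $\{V(\Gamma)\times\{x\}: x\in V(\Sigma)\}$. An automorphism of $\Gamma\times\Sigma$ is a $\Sigma$-mixer if it does not preserve the $\Sigma$-partition. A graph (loops allowed) is prime with respect to the direct product if it has more than one vertex and, whenever it is isomorphic to $A\times B$ with $A,B$ graphs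 possibly having loops, one of $A,B$ has exactly one vertex. Every connected non-bipartite graph has a unique factorization into primes (loops allowed in the factors), up to order and isomorphism. A connected non-bipartite twin-free graph $\Gamma$ with direct-prime factorization $\Gamma\cong\Gamma_1\times\cdots\times\Gamma_n$ is factor-loopless if each $\Gamma_i$ is loopless. *)

theory Defs
  imports "Graph_Theory.Graph_Theory" "HOL-Library.FuncSet"
begin

text \<open>
  A finite undirected graph without multiple edges, loops allowed, is a
  \<^locale>\<open>pair_pseudo_graph\<close>: a finite vertex set with a symmetric set of arcs, where
  \<open>(u, v) \<in> parcs G\<close> means that \<open>u\<close> is adjacent to \<open>v\<close>.
\<close>

type_synonym 'a graph = "'a pair_pre_digraph"

abbreviation is_graph :: "'a graph \<Rightarrow> bool" where
  "is_graph \<equiv> pair_pseudo_graph"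

definition connected_graph :: "'a graph \<Rightarrow> bool" where
  "connected_graph G \<longleftrightarrow> Digraph_Component.connected (with_proj G)"

definition isomorphic :: "'a graph \<Rightarrow> 'b graph \<Rightarrow> bool" (infix \<open>\<simeq>\<^sub>g\<close> 50) where
  "G \<simeq>\<^sub>g H \<longleftrightarrow> digraph_iso (with_proj G) (with_proj H)"

text \<open>
  Being \<^const>\<open>extensional\<close> makes an automorphism determined by its values on the vertices, so that
  sets of automorphisms can be compared by equality.
\<close>

definition Aut :: "'a graph \<Rightarrow> ('a \<Rightarrow> 'a) set" where
  "Aut G = {f \<in> extensional (pverts G). bij_betw f (pverts G) (pverts G) \<and>
    (\<forall>u\<in>pverts G. \<forall>v\<in>pverts G. (u, v) \<in> parcs G \<longleftrightarrow> (f u, f v) \<in> parcs G)}"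

definition direct_prod :: "'a graph \<Rightarrow> 'b graph \<Rightarrow> ('a \<times> 'b) graph" (infixr \<open>\<times>\<^sub>g\<close> 70) where
  "G \<times>\<^sub>g H = \<lparr> pverts = pverts G \<times> pverts H,
     parcs = {((u, v), (x, y)) | u v x y. (u, x) \<in> parcs G \<and> (v, y) \<in> parcs H} \<rparr>"

text \<open>
  The product of no factors is the one-vertex graph with a loop, the unit of the direct product.
\<close>

definition direct_prod_list :: "'a graph list \<Rightarrow> 'a list graph" where
  "direct_prod_list Gs = \<lparr>
     pverts = {xs. length xs = length Gs \<and> (\<forall>i<length Gs. xs ! i \<in> pverts (Gs ! i))},
     parcs = {(xs, ys). length xs = length Gs \<and> length ys = length Gs \<and>
       (\<forall>i<length Gs. (xs ! i, ys ! i) \<in> parcs (Gs ! i))} \<rparr>"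

definition prod_map :: "'a graph \<Rightarrow> 'b graph \<Rightarrow> ('a \<Rightarrow> 'a) \<Rightarrow> ('b \<Rightarrow> 'b) \<Rightarrow> 'a \<times> 'b \<Rightarrow> 'a \<times> 'b" where
  "prod_map G H f g = restrict (\<lambda>(x, y). (f x, g y)) (pverts G \<times> pverts H)"

definition stable :: "'a graph \<Rightarrow> 'b graph \<Rightarrow> bool" where
  "stable G H \<longleftrightarrow> Aut (G \<times>\<^sub>g H) = {prod_map G H f g | f g. f \<in> Aut G \<and> g \<in> Aut H}"

abbreviation unstable :: "'a graph \<Rightarrow> 'b graph \<Rightarrow> bool" where
  "unstable G H \<equiv> \<not> stable G H"

definition neighbourhood :: "'a graph \<Rightarrow> 'a \<Rightarrow> 'a set" where
  "neighbourhood G u = {v \<in> pverts G. (u, v) \<in> parcs G}"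

definition twin_free :: "'a graph \<Rightarrow> bool" where
  "twin_free G \<longleftrightarrow> inj_on (neighbourhood G) (pverts G)"

definition loopless :: "'a graph \<Rightarrow> bool" where
  "loopless G \<longleftrightarrow> (\<forall>v\<in>pverts G. (v, v) \<notin> parcs G)"

definition bipartition :: "'a graph \<Rightarrow> 'a set \<Rightarrow> 'a set \<Rightarrow> bool" where
  "bipartition G A B \<longleftrightarrow> A \<union> B = pverts G \<and> A \<inter> B = {} \<and>
    (\<forall>(u, v) \<in> parcs G. u \<in> A \<and> v \<in> B \<or> u \<in> B \<and> v \<in> A)"

definition bipartite :: "'a graph \<Rightarrow> bool" where
  "bipartite G \<longleftrightarrow> (\<exists>A B. bipartition G A B)"

text \<open>
  Every finite graph is isomorphic to one with vertices in \<^typ>\<open>nat\<close>, so quantifying over graphs on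
  \<^typ>\<open>nat\<close> amounts to quantifying over all finite graphs.
\<close>

definition coprime_graphs :: "'a graph \<Rightarrow> 'b graph \<Rightarrow> bool" where
  "coprime_graphs G H \<longleftrightarrow> \<not> (\<exists>(D :: nat graph) (G' :: nat graph) (H' :: nat graph).
     is_graph D \<and> is_graph G' \<and> is_graph H' \<and> card (pverts D) > 1 \<and>
     G \<simeq>\<^sub>g G' \<times>\<^sub>g D \<and> H \<simeq>\<^sub>g H' \<times>\<^sub>g D)"

definition prime_graph :: "'a graph \<Rightarrow> bool" where
  "prime_graph G \<longleftrightarrow> is_graph G \<and> card (pverts G) > 1 \<and>
     (\<forall>(A :: nat graph) (B :: nat graph). is_graph A \<and> is_graph B \<and> G \<simeq>\<^sub>g A \<times>\<^sub>g B \<longrightarrow>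
        card (pverts A) = 1 \<or> card (pverts B) = 1)"

text \<open>
  \<^const>\<open>bipartite\<close> admits an empty partite set, hence the loopless one-vertex graph;
  the last two conjuncts exclude it as the bipartite member.
\<close>

definition nontrivial_pair :: "'a graph \<Rightarrow> 'b graph \<Rightarrow> bool" where
  "nontrivial_pair G H \<longleftrightarrow>
     is_graph G \<and> is_graph H \<and> coprime_graphs G H \<and>
     connected_graph G \<and> connected_graph H \<and> twin_free G \<and> twin_free H \<and>
     (bipartite G \<longleftrightarrow> \<not> bipartite H) \<and>
     (bipartite G \<longrightarrow> (\<exists>A B. bipartition G A B \<and> A \<noteq> {} \<and> B \<noteq> {})) \<and>
     (bipartite H \<longrightarrow> (\<exists>A B. bipartition H A B \<and> A \<noteq> {} \<and> B \<noteq> {}))"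

definition nontrivially_unstable :: "'a graph \<Rightarrow> 'b graph \<Rightarrow> bool" where
  "nontrivially_unstable G H \<longleftrightarrow> nontrivial_pair G H \<and> unstable G H"

definition snd_partition :: "'a graph \<Rightarrow> 'b graph \<Rightarrow> ('a \<times> 'b) set set" where
  "snd_partition G H = {pverts G \<times> {x} | x. x \<in> pverts H}"

text \<open>For a pair \<open>(\<Gamma>, \<Sigma>)\<close>, \<open>mixer \<Gamma> \<Sigma> f\<close> says that \<open>f\<close> is a \<open>\<Sigma>\<close>-mixer of \<open>\<Gamma> \<times> \<Sigma>\<close>.\<close>

definition mixer :: "'a graph \<Rightarrow> 'b graph \<Rightarrow> ('a \<times> 'b \<Rightarrow> 'a \<times> 'b) \<Rightarrow> bool" where
  "mixer G H f \<longleftrightarrow> f \<in> Aut (G \<times>\<^sub>g H) \<and> (\<lambda>B. f ` B) ` snd_partition G H \<noteq> snd_partition G H"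

definition prime_factorization_of :: "'a graph \<Rightarrow> nat graph list \<Rightarrow> bool" where
  "prime_factorization_of G Gs \<longleftrightarrow> (\<forall>F\<in>set Gs. prime_graph F) \<and> G \<simeq>\<^sub>g direct_prod_list Gs"

definition factor_loopless :: "'a graph \<Rightarrow> bool" where
  "factor_loopless G \<longleftrightarrow>
     is_graph G \<and> connected_graph G \<and> \<not> bipartite G \<and> twin_free G \<and>
     (\<exists>Gs. prime_factorization_of G Gs \<and> (\<forall>F\<in>set Gs. loopless F))"

text \<open>The library notion of isomorphism agrees with adjacency-preserving bijections of vertices.\<close>

lemma isomorphic_iff:
  assumes "is_graph G" and "is_graph H"
  shows "G \<simeq>\<^sub>g H \<longleftrightarrow> (\<exists>f. bij_betw f (pverts G) (pverts H) \<and>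
    (\<forall>u\<in>pverts G. \<forall>v\<in>pverts G. (u, v) \<in> parcs G \<longleftrightarrow> (f u, f v) \<in> parcs H))"
    (is "_ \<longleftrightarrow> (\<exists>f. ?iso f)")
proof
  interpret G: pair_pseudo_graph G by fact
  interpret H: pair_pseudo_graph H by fact
  assume "G \<simeq>\<^sub>g H"
  then obtain h where h: "pre_digraph.digraph_isomorphism (with_proj G) h"
    and H: "with_proj H = app_iso h (with_proj G)"
    unfolding isomorphic_def digraph_iso_def by blast
  let ?f = "iso_verts h"
  have V: "pverts H = ?f ` pverts G" using arg_cong[OF H, of verts] by simp
  have A: "parcs H = iso_arcs h ` parcs G" using arg_cong[OF H, of arcs] by simp
  have t: "iso_tail h = fst" using arg_cong[OF H, of tail] by simp
  have hd: "iso_head h = snd" using arg_cong[OF H, of head] by simp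
  have inj: "inj_on ?f (pverts G)"
    using h unfolding pre_digraph.digraph_isomorphism_def by simp
  have ar: "iso_arcs h a = (?f (fst a), ?f (snd a))" if "a \<in> parcs G" for a
    using h that unfolding pre_digraph.digraph_isomorphism_def t hd by (auto simp: prod_eq_iff)
  have "(u, v) \<in> parcs G \<longleftrightarrow> (?f u, ?f v) \<in> parcs H" if "u \<in> pverts G" "v \<in> pverts G" for u v
  proof
    assume "(u, v) \<in> parcs G"
    then show "(?f u, ?f v) \<in> parcs H" using ar A by force
  next
    assume "(?f u, ?f v) \<in> parcs H"
    then obtain a where a: "a \<in> parcs G" "(?f u, ?f v) = iso_arcs h a" using A by auto
    then have "fst a = u" "snd a = v"
      using ar[OF a(1)] that inj G.arc_fst_in_verts[OF a(1)] G.arc_snd_in_verts[OF a(1)]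
      by (auto dest: inj_onD)
    then show "(u, v) \<in> parcs G" using a(1) by (metis prod.collapse)
  qed
  then show "\<exists>f. ?iso f" using inj V by (auto simp: bij_betw_def intro!: exI[of _ ?f])
next
  interpret G: pair_pseudo_graph G by fact
  interpret H: pair_pseudo_graph H by fact
  assume "\<exists>f. ?iso f"
  then obtain f where bij: "bij_betw f (pverts G) (pverts H)"
    and adj: "\<And>u v. u \<in> pverts G \<Longrightarrow> v \<in> pverts G \<Longrightarrow>
      (u, v) \<in> parcs G \<longleftrightarrow> (f u, f v) \<in> parcs H" by blast
  define h where
    "h = \<lparr> iso_verts = f, iso_arcs = map_prod f f, iso_head = snd, iso_tail = fst \<rparr>"
  have inj: "inj_on f (pverts G)" and V: "f ` pverts G = pverts H"
    using bij by (auto simp: bij_betw_def)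
  have sub: "parcs G \<subseteq> pverts G \<times> pverts G"
    using G.in_arcsD1 G.in_arcsD2 by auto
  have "inj_on (map_prod f f) (parcs G)"
    using map_prod_inj_on[OF inj inj] sub by (rule inj_on_subset)
  then have iso: "pre_digraph.digraph_isomorphism (with_proj G) h"
    unfolding pre_digraph.digraph_isomorphism_def h_def using inj G.wf_digraph by auto
  have "map_prod f f ` parcs G = parcs H"
  proof
    show "map_prod f f ` parcs G \<subseteq> parcs H" using adj sub by auto
    show "parcs H \<subseteq> map_prod f f ` parcs G"
    proof
      fix e assume e: "e \<in> parcs H"
      then obtain u v where "u \<in> pverts G" "v \<in> pverts G" "e = (f u, f v)"
        using V H.in_arcsD1 H.in_arcsD2 by (metis imageE prod.collapse)
      then show "e \<in> map_prod f f ` parcs G" using adj e by force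
    qed
  qed
  then have "with_proj H = app_iso h (with_proj G)"
    unfolding app_iso_def h_def using V by (simp add: with_proj_def)
  then show "G \<simeq>\<^sub>g H" unfolding isomorphic_def digraph_iso_def using iso by blast
qed

end

theory Submission
  imports Defs Complex_Main
begin

text \<open>
  Both \<open>\<Gamma> \<times> \<Sigma>\<close> and its image under an automorphism \<open>f\<close> are direct products on the same vertex set.
  The quantity \<open>ln |N(x)| + ln |N(y)| - 2 ln |N(x) \<inter> N(y)|\<close> is additive over direct products, so the
  shortest-path distance it generates is an intrinsic metric on every class of vertices joined by
  even walks, and it is the sum of the distances of the coordinates for each of the two products.
  Fibres of either product are then geodesically convex, which forces the two coordinate-mixing
  operations to commute (strict refinement).

  Fix a prime loopless factor \<open>G\<close> of \<open>\<Gamma>\<close>. The second product structure induces two commuting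
  rectangular bands \<open>E\<close>, \<open>F\<close> on \<open>V(G)\<close>, one for the fibre of \<open>G\<close> over each end of an edge of the
  complementary factor, and \<open>(E, F)\<close> preserves adjacency. Primality leaves three
  cases: \<open>E\<close> and \<open>F\<close> are both the first projection, both the second projection, or
  \<open>E y x = F x y\<close>. The last one produces a loop \<open>(E y x, F x y)\<close> from an arc \<open>(x, y)\<close>; the second one
  makes \<open>G\<close> a factor of \<open>\<Sigma>\<close>, against coprimality. In the first one the \<open>\<Sigma>\<close>-coordinate of \<open>f\<close>
  does not depend on the \<open>G\<close>-coordinate, and if this holds for every prime factor of \<open>\<Gamma>\<close> then
  \<open>f\<close> preserves the \<open>\<Sigma>\<close>-partition.
\<close>

section \<open>Strict refinement of l1 splittings\<close>

definition pseudometric_on :: "'a set \<Rightarrow> ('a \<Rightarrow> 'a \<Rightarrow> real) \<Rightarrow> bool" where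
  "pseudometric_on X d \<longleftrightarrow> (\<forall>x\<in>X. d x x = 0) \<and> (\<forall>x\<in>X. \<forall>y\<in>X. d x y \<ge> 0 \<and> d x y = d y x) \<and>
     (\<forall>x\<in>X. \<forall>y\<in>X. \<forall>z\<in>X. d x z \<le> d x y + d y z)"

text \<open>Models a product of metric spaces: \<open>p\<close> and \<open>q\<close> are the
  distances of the two coordinates, and \<open>p + q\<close> is the metric. The last clause supplies
  the point with the first coordinate of \<open>x\<close> and the second coordinate of
  \<open>y\<close>.\<close>

definition l1_split :: "'a set \<Rightarrow> ('a \<Rightarrow> 'a \<Rightarrow> real) \<Rightarrow> ('a \<Rightarrow> 'a \<Rightarrow> real) \<Rightarrow> bool" where
  "l1_split X p q \<longleftrightarrow> pseudometric_on X p \<and> pseudometric_on X q \<and>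
     (\<forall>x\<in>X. \<forall>y\<in>X. p x y + q x y = 0 \<longrightarrow> x = y) \<and>
     (\<forall>x\<in>X. \<forall>y\<in>X. \<exists>z\<in>X. p x z = 0 \<and> q z y = 0)"

text \<open>Under \<open>l1_split\<close> the choice is unique, because \<open>p + q\<close>
  separates points; see \<open>mix_eqI\<close>.\<close>

definition mix :: "'a set \<Rightarrow> ('a \<Rightarrow> 'a \<Rightarrow> real) \<Rightarrow> ('a \<Rightarrow> 'a \<Rightarrow> real) \<Rightarrow> 'a \<Rightarrow> 'a \<Rightarrow> 'a" where
  "mix X p q x y = (SOME z. z \<in> X \<and> p x z = 0 \<and> q z y = 0)"

lemma pseudometric_onD:
  assumes "pseudometric_on X d" "x \<in> X" "y \<in> X" "z \<in> X"
  shows "d x x = 0" "d x y \<ge> 0" "d x y = d y x" "d x z \<le> d x y + d y z"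
  using assms unfolding pseudometric_on_def by blast+

lemma pseudometric_on_shift:
  assumes "pseudometric_on X d" "x \<in> X" "y \<in> X" "z \<in> X" "d x y = 0"
  shows "d x z = d y z" "d z x = d z y"
  using pseudometric_onD[OF assms(1)] assms by (smt (verit))+

locale l1_splitting =
  fixes X :: "'a set" and p q :: "'a \<Rightarrow> 'a \<Rightarrow> real"
  assumes split: "l1_split X p q"
begin

abbreviation m where "m \<equiv> mix X p q"

lemma pseudo: "pseudometric_on X p" "pseudometric_on X q"
  using split unfolding l1_split_def by auto

lemmas p = pseudometric_onD[OF pseudo(1)] and q = pseudometric_onD[OF pseudo(2)]

lemma mix: assumes "x \<in> X" "y \<in> X"
  shows "m x y \<in> X" "p x (m x y) = 0" "q (m x y) y = 0"
proof -
  have "\<exists>z. z \<in> X \<and> p x z = 0 \<and> q z y = 0" using split assms unfolding l1_split_def by blast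
  from someI_ex[OF this] show "m x y \<in> X" "p x (m x y) = 0" "q (m x y) y = 0"
    unfolding mix_def by auto
qed

lemma eqI: assumes "x \<in> X" "y \<in> X" "p x y = 0" "q x y = 0" shows "x = y"
  using split assms unfolding l1_split_def by auto

lemma mix_eqI:
  assumes "x \<in> X" "y \<in> X" "z \<in> X" "p x z = 0" "q z y = 0" shows "m x y = z"
proof (rule eqI)
  show "p (m x y) z = 0"
    using mix[OF assms(1,2)] assms p(3) pseudometric_on_shift(1)[OF pseudo(1)] by metis
  show "q (m x y) z = 0"
    using mix[OF assms(1,2)] assms q(3) pseudometric_on_shift(2)[OF pseudo(2)] by metis
qed (use mix assms in auto)

lemma mix_idem: "x \<in> X \<Longrightarrow> m x x = x"
  by (rule mix_eqI) (auto simp: p q)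

lemma mix_left: assumes "x \<in> X" "y \<in> X" "z \<in> X" shows "m (m x y) z = m x z"
proof (rule mix_eqI)
  show "p (m x y) (m x z) = 0"
    using mix assms pseudometric_on_shift(1)[OF pseudo(1)] by metis
qed (use mix assms in auto)

lemma mix_right: assumes "x \<in> X" "y \<in> X" "z \<in> X" shows "m x (m y z) = m x z"
proof (rule mix_eqI)
  show "q (m x z) (m y z) = 0"
    using mix assms pseudometric_on_shift(2)[OF pseudo(2)] q(3) by metis
qed (use mix assms in auto)

lemma q_mix: assumes "x \<in> X" "y \<in> X" shows "q x (m x y) = q x y" "p (m x y) y = p x y"
  using mix[OF assms] assms pseudometric_on_shift[OF pseudo(2)] pseudometric_on_shift[OF pseudo(1)]
  by metis+

text \<open>The way from \<open>x\<close> to \<open>m x y\<close> changes only the second coordinate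
  and the way on to \<open>y\<close> only the first, so the mixed point lies between
  \<open>x\<close> and \<open>y\<close>. Betweenness depends on the sum metric alone, which lets it
  pass from one splitting to another.\<close>

lemma geodesic:
  assumes "x \<in> X" "y \<in> X"
  shows "p x y + q x y = (p x (m x y) + q x (m x y)) + (p (m x y) y + q (m x y) y)"
  using q_mix[OF assms] mix[OF assms] by simp

lemma swap: "l1_splitting X q p"
proof
  have "\<exists>z\<in>X. q x z = 0 \<and> p z y = 0" if "x \<in> X" "y \<in> X" for x y
    using mix[OF that(2,1)] that p(3) q(3) by (intro bexI[of _ "m y x"]) metis+
  then show "l1_split X q p"
    using split unfolding l1_split_def by (simp add: add.commute)
qed

lemma mix_swap: assumes "x \<in> X" "y \<in> X" shows "mix X q p x y = m y x"
proof (rule l1_splitting.mix_eqI[OF swap])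
  show "q x (m y x) = 0" "p (m y x) y = 0" using mix[of y x] assms p(3) q(3) by metis+
qed (use mix assms in auto)

end

locale two_l1_splittings = S: l1_splitting X p q + T: l1_splitting X r s
  for X :: "'a set" and p q r s +
  assumes same: "\<And>x y. x \<in> X \<Longrightarrow> y \<in> X \<Longrightarrow> p x y + q x y = r x y + s x y"
begin

lemma variants: "two_l1_splittings X q p r s" "two_l1_splittings X p q s r"
  "two_l1_splittings X r s p q"
  using same S.swap T.swap S.l1_splitting_axioms T.l1_splitting_axioms
  by (auto simp: two_l1_splittings_def two_l1_splittings_axioms_def add.commute)

text \<open>Both \<open>r\<close> and \<open>s\<close> satisfy the triangle inequality, and equality
  for their sum forces equality for each.\<close>

lemma s_additive:
  assumes "x \<in> X" "y \<in> X" "z \<in> X"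
    and "p x z + q x z = (p x y + q x y) + (p y z + q y z)"
  shows "s x z = s x y + s y z"
  using assms same[of x z] same[of x y] same[of y z] S.p S.q T.p(4)[of x y z] T.q(4)[of x y z]
  by simp

lemma s_geodesic:
  assumes "x \<in> X" "y \<in> X" shows "s x y = s x (S.m x y) + s (S.m x y) y"
  by (rule s_additive) (use assms S.mix S.geodesic in auto)

lemma s_convex:
  assumes "x \<in> X" "y \<in> X" "s x y = 0" shows "s x (S.m x y) = 0"
  using s_geodesic[OF assms(1,2)] assms S.mix[OF assms(1,2)] T.q(2)
  by (smt (verit))

text \<open>The points \<open>x\<close>, \<open>x'\<close>, \<open>m x' y\<close>,
  \<open>m x y\<close> form a rectangle in which each corner lies between its two neighbours. The
  four additivity equations for \<open>s\<close> make opposite sides equally long, and the side from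
  \<open>x\<close> to \<open>x'\<close> has length 0.\<close>

lemma s_mix_cong_aux:
  assumes "x \<in> X" "x' \<in> X" "y \<in> X" "s x x' = 0" "q x x' = 0"
  shows "s (S.m x y) (S.m x' y) = 0"
proof -
  let ?u = "S.m x y" and ?v = "S.m x' y"
  have in_X: "?u \<in> X" "?v \<in> X" using S.mix assms by auto
  have m1: "S.m x ?v = ?u" "S.m x' ?u = ?v" by (simp_all add: S.mix_right assms)
  have "S.m x' x = x'" "S.m x x' = x"
    by (rule S.mix_eqI; use assms S.p S.q in auto)+
  then have m2: "S.m ?v x = x'" "S.m ?u x' = x" by (simp_all add: S.mix_left assms)
  have "s x ?v = s x ?u + s ?u ?v" "s x' ?u = s x' ?v + s ?v ?u"
    "s ?v x = s ?v x' + s x' x" "s ?u x' = s ?u x + s x x'"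
    using s_geodesic[of x ?v] s_geodesic[of x' ?u] s_geodesic[of ?v x] s_geodesic[of ?u x']
      assms in_X m1 m2 by simp_all
  moreover have "s ?v x = s x ?v" "s ?v x' = s x' ?v" "s x' x = s x x'" "s ?u x' = s x' ?u"
    "s ?u x = s x ?u" "s ?u ?v = s ?v ?u" using T.q(3) assms in_X by auto
  ultimately show ?thesis using assms(4) by simp
qed

text \<open>Reduces to the rectangle: \<open>m x x'\<close> has the \<open>q\<close>-coordinate of
  \<open>x'\<close>, is at \<open>s\<close>-distance 0 from \<open>x\<close> by convexity, and can
  replace \<open>x\<close> as a left argument of mixing.\<close>

lemma s_mix_cong_left:
  assumes "x \<in> X" "x' \<in> X" "y \<in> X" "s x x' = 0"
  shows "s (S.m x y) (S.m x' y) = 0"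
proof -
  let ?w = "S.m x x'"
  have w: "?w \<in> X" "q ?w x' = 0" using S.mix assms by auto
  have "s x ?w = 0" using s_convex assms by blast
  then have "s ?w x' = 0"
    using pseudometric_on_shift(1)[OF T.pseudo(2), of x ?w x'] assms w by simp
  then have "s (S.m ?w y) (S.m x' y) = 0" using s_mix_cong_aux assms w by blast
  then show ?thesis by (simp add: S.mix_left assms)
qed

text \<open>Exchanging \<open>p\<close> and \<open>q\<close> exchanges the two arguments of
  mixing.\<close>

lemma s_mix_cong_right:
  assumes "x \<in> X" "y \<in> X" "y' \<in> X" "s y y' = 0"
  shows "s (S.m x y) (S.m x y') = 0"
proof -
  interpret W: two_l1_splittings X q p r s using variants by simp
  show ?thesis using W.s_mix_cong_left[of y y' x] assms by (simp add: S.mix_swap)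
qed

lemma s_mix_cong:
  assumes "x \<in> X" "x' \<in> X" "y \<in> X" "y' \<in> X" "s x x' = 0" "s y y' = 0"
  shows "s (S.m x y) (S.m x' y') = 0"
  using s_mix_cong_left[of x x' y] s_mix_cong_right[of x' y y'] assms S.mix T.q(2)
    T.q(4)[of "S.m x y" "S.m x' y" "S.m x' y'"] by (smt (verit))

text \<open>The right-hand side meets the two conditions that determine the left-hand side: being at
  \<open>r\<close>-distance 0, and likewise at \<open>s\<close>-distance 0, is a congruence for the
  mixing of the other splitting.\<close>

lemma mix_commute:
  assumes "x \<in> X" "y \<in> X" "z \<in> X" "w \<in> X"
  shows "T.m (S.m x y) (S.m z w) = S.m (T.m x z) (T.m y w)"
proof (rule T.mix_eqI)
  interpret W: two_l1_splittings X p q s r using variants by simp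
  show "r (S.m x y) (S.m (T.m x z) (T.m y w)) = 0"
    by (rule W.s_mix_cong) (use assms T.mix in auto)
  show "s (S.m (T.m x z) (T.m y w)) (S.m z w) = 0"
    by (rule s_mix_cong) (use assms T.mix in auto)
qed (use assms S.mix T.mix in auto)

end

section \<open>Commuting rectangular bands\<close>

text \<open>The laws of the operation on a product set that takes one coordinate from
  \<open>x\<close> and the complementary one from \<open>y\<close>.\<close>

locale rectangular_band =
  fixes V :: "'a set" and E :: "'a \<Rightarrow> 'a \<Rightarrow> 'a"
  assumes closed: "x \<in> V \<Longrightarrow> y \<in> V \<Longrightarrow> E x y \<in> V"
    and idem: "x \<in> V \<Longrightarrow> E x x = x"
    and left: "x \<in> V \<Longrightarrow> y \<in> V \<Longrightarrow> z \<in> V \<Longrightarrow> E (E x y) z = E x z"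
    and right: "x \<in> V \<Longrightarrow> y \<in> V \<Longrightarrow> z \<in> V \<Longrightarrow> E x (E y z) = E x z"

sublocale l1_splitting \<subseteq> rectangular_band X m
  by unfold_locales (auto simp: mix mix_idem mix_left mix_right)

lemma rectangular_band_cong:
  assumes "rectangular_band V E" and eq: "\<And>x y. x \<in> V \<Longrightarrow> y \<in> V \<Longrightarrow> E x y = E' x y"
  shows "rectangular_band V E'"
proof -
  interpret rectangular_band V E by fact
  have "E' x y \<in> V" if "x \<in> V" "y \<in> V" for x y using closed that eq by metis
  then show ?thesis by unfold_locales (simp_all add: eq[symmetric] idem left right)
qed

lemma rectangular_band_opposite:
  "rectangular_band V E \<Longrightarrow> rectangular_band V (\<lambda>x y. E y x)"
  unfolding rectangular_band_def by simp

locale commuting_bands = E: rectangular_band V E + F: rectangular_band V F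
  for V :: "'a set" and E F +
  assumes commute: "x \<in> V \<Longrightarrow> y \<in> V \<Longrightarrow> z \<in> V \<Longrightarrow> w \<in> V \<Longrightarrow>
    E (F x y) (F z w) = F (E x z) (E y w)"
begin

lemma meet_commute: "x \<in> V \<Longrightarrow> y \<in> V \<Longrightarrow> E (F x y) y = F (E x y) y"
  using commute[of x y y y] by (simp add: E.idem F.idem)

text \<open>
  Two commuting bands split \<open>V\<close> into four coordinates; this operation takes from \<open>x\<close> only the
  coordinate that both \<open>E\<close> and \<open>F\<close> take from their first argument.
\<close>

lemma meet_band: "rectangular_band V (\<lambda>x y. E (F x y) y)"
proof
  fix x y z assume V: "x \<in> V" "y \<in> V" "z \<in> V"
  show "E (F x y) y \<in> V" "E (F x x) x = x" using V by (simp_all add: E.closed F.closed E.idem F.idem)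
  have "F (E (F x y) y) z = E (F x z) (F y z)"
    using commute[of "F x y" z y z] V by (simp add: E.closed F.closed E.idem F.left)
  then show "E (F (E (F x y) y) z) z = E (F x z) z"
    using V by (simp add: E.closed F.closed E.left)
  have "F x (E (F y z) z) = F x z"
    using V by (simp add: meet_commute E.closed F.closed F.right)
  then show "E (F x (E (F y z) z)) (E (F y z) z) = E (F x z) z"
    using V by (simp add: E.closed F.closed E.right)
qed

end

section \<open>Graphs and their direct products\<close>

lemma is_graph_iff:
  "is_graph G \<longleftrightarrow> finite (pverts G) \<and> parcs G \<subseteq> pverts G \<times> pverts G \<and> sym (parcs G)"
proof
  assume "is_graph G"
  then interpret pair_pseudo_graph G .
  show "finite (pverts G) \<and> parcs G \<subseteq> pverts G \<times> pverts G \<and> sym (parcs G)"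
    using pair_finite_verts in_arcsD1 in_arcsD2 symmetric_conv[of "with_proj G"] sym_arcs
    by (auto simp: symmetric_def)
next
  assume G: "finite (pverts G) \<and> parcs G \<subseteq> pverts G \<times> pverts G \<and> sym (parcs G)"
  then have "finite (parcs G)" by (meson finite_SigmaI finite_subset)
  with G show "is_graph G" by unfold_locales (auto simp: symmetric_def)
qed

lemma is_graphD:
  assumes "is_graph G"
  shows "finite (pverts G)" "(u, v) \<in> parcs G \<Longrightarrow> u \<in> pverts G"
    "(u, v) \<in> parcs G \<Longrightarrow> v \<in> pverts G" "(u, v) \<in> parcs G \<Longrightarrow> (v, u) \<in> parcs G"
  using assms unfolding is_graph_iff sym_def by auto

lemma finite_neighbourhood: "is_graph G \<Longrightarrow> finite (neighbourhood G x)"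
  using is_graphD(1) unfolding neighbourhood_def by force

lemma in_neighbourhood_iff: "is_graph G \<Longrightarrow> y \<in> neighbourhood G x \<longleftrightarrow> (x, y) \<in> parcs G"
  using is_graphD(3) unfolding neighbourhood_def by force

lemma direct_prod_simps [simp]:
  "pverts (G \<times>\<^sub>g H) = pverts G \<times> pverts H"
  "((a, b), (a', b')) \<in> parcs (G \<times>\<^sub>g H) \<longleftrightarrow> (a, a') \<in> parcs G \<and> (b, b') \<in> parcs H"
  by (auto simp: direct_prod_def)

lemma direct_prod_arc_iff:
  "(x, y) \<in> parcs (G \<times>\<^sub>g H) \<longleftrightarrow> (fst x, fst y) \<in> parcs G \<and> (snd x, snd y) \<in> parcs H"
  by (cases x; cases y) simp

lemma is_graph_direct_prod: "is_graph G \<Longrightarrow> is_graph H \<Longrightarrow> is_graph (G \<times>\<^sub>g H)"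
  unfolding is_graph_iff by (auto simp: sym_def direct_prod_arc_iff)

lemma neighbourhood_direct_prod:
  "neighbourhood (G \<times>\<^sub>g H) (a, b) = neighbourhood G a \<times> neighbourhood H b"
  unfolding neighbourhood_def by auto

section \<open>Isomorphisms as explicit maps\<close>

definition graph_iso :: "('a \<Rightarrow> 'b) \<Rightarrow> 'a graph \<Rightarrow> 'b graph \<Rightarrow> bool" where
  "graph_iso f G H \<longleftrightarrow> bij_betw f (pverts G) (pverts H) \<and>
     (\<forall>u\<in>pverts G. \<forall>v\<in>pverts G. (u, v) \<in> parcs G \<longleftrightarrow> (f u, f v) \<in> parcs H)"

lemma isomorphic_iff_graph_iso:
  "is_graph G \<Longrightarrow> is_graph H \<Longrightarrow> G \<simeq>\<^sub>g H \<longleftrightarrow> (\<exists>f. graph_iso f G H)"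
  unfolding graph_iso_def by (rule isomorphic_iff)

lemma graph_iso_inv:
  assumes "graph_iso f G H" shows "graph_iso (inv_into (pverts G) f) H G"
proof -
  let ?g = "inv_into (pverts G) f"
  have f: "bij_betw f (pverts G) (pverts H)" using assms unfolding graph_iso_def by blast
  have "?g u \<in> pverts G" "f (?g u) = u" if "u \<in> pverts H" for u
    using bij_betwE[OF bij_betw_inv_into[OF f]] bij_betw_inv_into_right[OF f] that by blast+
  then show ?thesis
    using assms bij_betw_inv_into[OF f] unfolding graph_iso_def by metis
qed

lemma graph_iso_comp:
  assumes "graph_iso f G H" "graph_iso g H K" shows "graph_iso (g \<circ> f) G K"
proof -
  have f: "bij_betw f (pverts G) (pverts H)" and g: "bij_betw g (pverts H) (pverts K)"
    using assms unfolding graph_iso_def by blast+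
  show ?thesis
    using assms bij_betw_trans[OF f g] bij_betwE[OF f] unfolding graph_iso_def o_apply by metis
qed

lemma graph_iso_direct_prod:
  assumes "graph_iso f G G'" "graph_iso g H H'"
  shows "graph_iso (map_prod f g) (G \<times>\<^sub>g H) (G' \<times>\<^sub>g H')"
proof -
  have "bij_betw (map_prod f g) (pverts G \<times> pverts H) (pverts G' \<times> pverts H')"
    using assms unfolding graph_iso_def bij_betw_def by (metis map_prod_inj_on map_prod_surj_on)
  moreover have "(u, v) \<in> parcs G \<longleftrightarrow> (f u, f v) \<in> parcs G'" if "u \<in> pverts G" "v \<in> pverts G" for u v
    using assms(1) that unfolding graph_iso_def by blast
  moreover have "(u, v) \<in> parcs H \<longleftrightarrow> (g u, g v) \<in> parcs H'" if "u \<in> pverts H" "v \<in> pverts H" for u v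
    using assms(2) that unfolding graph_iso_def by blast
  ultimately show ?thesis unfolding graph_iso_def by simp
qed

text \<open>Primality and coprimality quantify over graphs on \<open>nat\<close>, so factors built
  on other types are copied there.\<close>

lemma ex_nat_graph_iso:
  assumes "is_graph G"
  shows "\<exists>f (H :: nat graph). is_graph H \<and> graph_iso f G H"
proof -
  obtain f :: "'a \<Rightarrow> nat" where f: "bij_betw f (pverts G) {0..<card (pverts G)}"
    using ex_bij_betw_finite_nat is_graphD(1)[OF assms] by blast
  define H where "H = \<lparr>pverts = f ` pverts G, parcs = map_prod f f ` parcs G\<rparr>"
  have inj: "inj_on f (pverts G)" using f by (rule bij_betw_imp_inj_on)
  have arc: "(a, b) \<in> parcs H \<longleftrightarrow> (\<exists>u v. (u, v) \<in> parcs G \<and> a = f u \<and> b = f v)" for a b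
    unfolding H_def by force
  have "is_graph H"
    using is_graphD[OF assms] unfolding is_graph_iff sym_def subset_iff
    by (simp add: arc H_def[THEN arg_cong, of pverts]) blast
  moreover have "(u, v) \<in> parcs G \<longleftrightarrow> (f u, f v) \<in> parcs H"
    if "u \<in> pverts G" "v \<in> pverts G" for u v
    using that is_graphD(2,3)[OF assms] inj_onD[OF inj] unfolding arc by metis
  then have "graph_iso f G H"
    using inj unfolding graph_iso_def by (simp add: bij_betw_def H_def)
  ultimately show ?thesis by blast
qed

lemma graph_iso_card: "graph_iso f G H \<Longrightarrow> card (pverts G) = card (pverts H)"
  unfolding graph_iso_def by (auto simp: bij_betw_same_card)

section \<open>A metric additive over direct products\<close>

text \<open>Nonnegative when the neighbourhoods meet, and then zero only if they coincide, so
  twin-freeness turns it into a separating cost.\<close>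

definition step_cost :: "'a graph \<Rightarrow> 'a \<Rightarrow> 'a \<Rightarrow> real" where
  "step_cost G x y = ln (card (neighbourhood G x)) + ln (card (neighbourhood G y)) -
     2 * ln (card (neighbourhood G x \<inter> neighbourhood G y))"

text \<open>Steps join vertices with a common neighbour, so chains are even walks. The
  \<open>nil\<close> case asks for a neighbour so that in a product this coordinate can stand still
  while the other one moves.\<close>

inductive chain :: "'a graph \<Rightarrow> 'a \<Rightarrow> 'a \<Rightarrow> real \<Rightarrow> bool" for G where
  nil: "x \<in> pverts G \<Longrightarrow> neighbourhood G x \<noteq> {} \<Longrightarrow> chain G x x 0"
| step: "chain G x y c \<Longrightarrow> z \<in> pverts G \<Longrightarrow> neighbourhood G y \<inter> neighbourhood G z \<noteq> {} \<Longrightarrow>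
    chain G x z (c + step_cost G y z)"

definition linked :: "'a graph \<Rightarrow> 'a \<Rightarrow> 'a \<Rightarrow> bool" where
  "linked G x y \<longleftrightarrow> (\<exists>c. chain G x y c)"

definition chain_dist :: "'a graph \<Rightarrow> 'a \<Rightarrow> 'a \<Rightarrow> real" where
  "chain_dist G x y = Inf {c. chain G x y c}"

lemma chain_verts:
  "chain G x y c \<Longrightarrow> x \<in> pverts G \<and> y \<in> pverts G \<and> neighbourhood G x \<noteq> {} \<and> neighbourhood G y \<noteq> {}"
  by (induction rule: chain.induct) auto

lemma step_cost_sym: "step_cost G x y = step_cost G y x"
  unfolding step_cost_def by (simp add: Int_commute)

lemma step_cost_nonneg:
  assumes "is_graph G" "neighbourhood G x \<inter> neighbourhood G y \<noteq> {}"
  shows "step_cost G x y \<ge> 0"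
proof -
  have fin: "finite (neighbourhood G z)" for z using finite_neighbourhood[OF assms(1)] .
  let ?c = "card (neighbourhood G x \<inter> neighbourhood G y)"
  have "?c > 0" using assms fin by (simp add: card_gt_0_iff)
  moreover have "?c \<le> card (neighbourhood G x)" "?c \<le> card (neighbourhood G y)"
    by (auto intro: card_mono fin)
  ultimately have "ln (real ?c) \<le> ln (card (neighbourhood G x))"
    "ln (real ?c) \<le> ln (card (neighbourhood G y))" by simp_all
  then show ?thesis unfolding step_cost_def by simp
qed

lemma step_cost_pos:
  assumes "is_graph G" "twin_free G" "x \<in> pverts G" "y \<in> pverts G" "x \<noteq> y"
    "neighbourhood G x \<inter> neighbourhood G y \<noteq> {}"
  shows "step_cost G x y > 0"
proof -
  let ?N = "neighbourhood G"
  have fin: "finite (?N z)" for z using finite_neighbourhood[OF assms(1)] .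
  have "?N x \<noteq> ?N y" using assms unfolding twin_free_def inj_on_def by blast
  then have "?N x \<inter> ?N y \<subset> ?N x \<or> ?N x \<inter> ?N y \<subset> ?N y" by blast
  then have "card (?N x \<inter> ?N y) < card (?N x) \<or> card (?N x \<inter> ?N y) < card (?N y)"
    using psubset_card_mono fin by metis
  moreover have "card (?N x \<inter> ?N y) > 0" using assms fin by (simp add: card_gt_0_iff)
  moreover have "card (?N x \<inter> ?N y) \<le> card (?N x)" "card (?N x \<inter> ?N y) \<le> card (?N y)"
    by (auto intro: card_mono fin)
  ultimately have "ln (card (?N x \<inter> ?N y)) < ln (card (?N x)) \<or>
      ln (card (?N x \<inter> ?N y)) < ln (card (?N y))"
    "ln (card (?N x \<inter> ?N y)) \<le> ln (card (?N x))" "ln (card (?N x \<inter> ?N y)) \<le> ln (card (?N y))"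
    by auto
  then show ?thesis unfolding step_cost_def by linarith
qed

lemma chain_nonneg: "chain G x y c \<Longrightarrow> is_graph G \<Longrightarrow> c \<ge> 0"
  by (induction rule: chain.induct) (auto simp: step_cost_nonneg)

lemma chain_trans: "chain G y z d \<Longrightarrow> chain G x y c \<Longrightarrow> chain G x z (c + d)"
proof (induction rule: chain.induct)
  case (step u v e w)
  then show ?case using chain.step[of G x v "c + e" w] by (simp add: add.assoc)
qed simp

lemma chain_single:
  assumes "x \<in> pverts G" "y \<in> pverts G" "neighbourhood G x \<inter> neighbourhood G y \<noteq> {}"
  shows "chain G x y (step_cost G x y)"
  using chain.step[OF chain.nil, of x G y] assms by auto

lemma chain_sym: "chain G x y c \<Longrightarrow> chain G y x c"
proof (induction rule: chain.induct)
  case (step x y c z)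
  then have "chain G z y (step_cost G y z)"
    using chain_single[of z G y] chain_verts[OF step(1)] by (auto simp: Int_commute step_cost_sym)
  from chain_trans[OF step(4) this] show ?case by (simp add: add.commute)
qed (rule chain.nil)

lemma linked_refl: "x \<in> pverts G \<Longrightarrow> neighbourhood G x \<noteq> {} \<Longrightarrow> linked G x x"
  and linked_sym: "linked G x y \<Longrightarrow> linked G y x"
  and linked_trans: "linked G x y \<Longrightarrow> linked G y z \<Longrightarrow> linked G x z"
  and linked_verts: "linked G x y \<Longrightarrow> x \<in> pverts G \<and> y \<in> pverts G"
  unfolding linked_def using chain.nil chain_sym chain_trans chain_verts by metis+

text \<open>Any two neighbours of one vertex are linked. Along a chain, consecutive vertices share a
  neighbour \<open>w\<close>, through which the linked pair is passed on.\<close>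

lemma linked_neighbours:
  assumes G: "is_graph G" and "linked G x x'" "(x, y) \<in> parcs G" "(x', y') \<in> parcs G"
  shows "linked G y y'"
proof -
  have common: "linked G u v" if "(w, u) \<in> parcs G" "(w, v) \<in> parcs G" for u v w
  proof -
    have "w \<in> neighbourhood G u \<inter> neighbourhood G v"
      using that G by (auto simp: in_neighbourhood_iff intro: is_graphD)
    then have "chain G u v (step_cost G u v)"
      by (intro chain_single is_graphD(3)[OF G that(1)] is_graphD(3)[OF G that(2)]) blast
    then show ?thesis unfolding linked_def by blast
  qed
  obtain c where "chain G x x' c" using assms unfolding linked_def by blast
  then show ?thesis using assms(3,4)
  proof (induction arbitrary: y' rule: chain.induct)
    case (nil x)
    then show ?case using common by blast
  next
    case (step x u c z)
    then obtain w where "(u, w) \<in> parcs G" "(z, w) \<in> parcs G"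
      using G by (auto simp: in_neighbourhood_iff)
    then have "linked G y w" "linked G w y'" using step.IH[of w] step.prems common[of z w y'] by auto
    then show ?case by (rule linked_trans)
  qed
qed

lemma
  assumes G: "is_graph G"
  shows chain_dist_nonneg: "linked G x y \<Longrightarrow> chain_dist G x y \<ge> 0"
    and chain_dist_le: "chain G x y c \<Longrightarrow> chain_dist G x y \<le> c"
    and chain_dist_sym: "chain_dist G x y = chain_dist G y x"
    and chain_dist_triangle: "linked G x y \<Longrightarrow> linked G y z \<Longrightarrow>
      chain_dist G x z \<le> chain_dist G x y + chain_dist G y z"
    and chain_dist_self: "linked G x x \<Longrightarrow> chain_dist G x x = 0"
proof -
  have bdd: "bdd_below {c. chain G x y c}" for x y
    using chain_nonneg[OF _ G] by (intro bdd_belowI[of _ 0]) blast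
  show le: "chain_dist G x y \<le> c" if "chain G x y c" for x y c
    unfolding chain_dist_def using that bdd by (intro cInf_lower) auto
  have ge: "b \<le> chain_dist G x y" if "linked G x y" "\<And>c. chain G x y c \<Longrightarrow> b \<le> c" for x y b
    unfolding chain_dist_def using that by (intro cInf_greatest) (auto simp: linked_def)
  show nonneg: "chain_dist G x y \<ge> 0" if "linked G x y" for x y
    by (rule ge) (use that chain_nonneg[OF _ G] in auto)
  show "chain_dist G x y = chain_dist G y x"
    unfolding chain_dist_def by (rule arg_cong[of _ _ Inf]) (auto intro: chain_sym)
  show "chain_dist G x x = 0" if "linked G x x"
    using that le[OF chain.nil, of x] nonneg[OF that] chain_verts
    unfolding linked_def by (metis antisym)
  assume l: "linked G x y" "linked G y z"
  have "chain_dist G x z - c \<le> chain_dist G y z" if "chain G x y c" for c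
    by (rule ge) (use l le[OF chain_trans[OF _ that]] in \<open>auto simp: algebra_simps\<close>)
  then have "chain_dist G x z - chain_dist G y z \<le> chain_dist G x y"
    by (intro ge) (use l in \<open>auto simp: algebra_simps\<close>)
  then show "chain_dist G x z \<le> chain_dist G x y + chain_dist G y z" by simp
qed

text \<open>An infimum of positive costs could vanish, but a finite graph has only finitely many
  step costs. A chain between distinct vertices contains a step between distinct vertices, and
  twin-freeness bounds its cost below by a fixed positive number.\<close>

lemma chain_dist_eq_0:
  assumes G: "is_graph G" "twin_free G" and l: "linked G x y" and 0: "chain_dist G x y = 0"
  shows "x = y"
proof (rule ccontr)
  assume neq: "x \<noteq> y"
  define W where "W = (\<lambda>(x, y). step_cost G x y) ` {(x, y). x \<in> pverts G \<and> y \<in> pverts G \<and> x \<noteq> y \<and>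
    neighbourhood G x \<inter> neighbourhood G y \<noteq> {}}"
  have "finite {(x, y). x \<in> pverts G \<and> y \<in> pverts G \<and> x \<noteq> y \<and>
    neighbourhood G x \<inter> neighbourhood G y \<noteq> {}}"
    by (rule finite_subset[of _ "pverts G \<times> pverts G"]) (use is_graphD(1)[OF G(1)] in auto)
  then have fin: "finite W" unfolding W_def by blast
  have "\<forall>w\<in>W. w > 0" unfolding W_def using step_cost_pos[OF G] by auto
  \<comment> \<open>\<open>insert 1\<close> keeps the minimum defined and positive when
    \<open>W\<close> is empty.\<close>
  then have pos: "Min (insert 1 W) > 0" using fin by simp
  have "u = v \<or> c \<ge> Min (insert 1 W)" if "chain G u v c" for u v c
    using that
  proof (induction rule: chain.induct)
    case (step u v c w)
    have c: "c \<ge> 0" "step_cost G v w \<ge> 0"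
      using chain_nonneg[OF step(1) G(1)] step_cost_nonneg[OF G(1) step(3)] by auto
    show ?case
    proof (cases "v = w")
      case True
      with step c show ?thesis by auto
    next
      case False
      then have "step_cost G v w \<in> W" unfolding W_def using step chain_verts by fastforce
      then have "step_cost G v w \<ge> Min (insert 1 W)" using fin by simp
      then show ?thesis using c by simp
    qed
  qed simp
  then have "chain_dist G x y \<ge> Min (insert 1 W)" unfolding chain_dist_def
    using l neq by (intro cInf_greatest) (auto simp: linked_def)
  then show False using pos 0 by simp
qed

section \<open>Chains and distances in products\<close>

lemma chain_direct_prod_left:
  assumes "is_graph G" "is_graph H" "chain G a a' c" "b \<in> pverts H" "neighbourhood H b \<noteq> {}"
  shows "chain (G \<times>\<^sub>g H) (a, b) (a', b) c"
  using assms(3)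
proof (induction rule: chain.induct)
  case (nil a)
  then show ?case using assms by (intro chain.nil) (auto simp: neighbourhood_direct_prod)
next
  case (step x y c z)

  have pos: "card (neighbourhood G y) > 0" "card (neighbourhood G z) > 0"
    "card (neighbourhood G y \<inter> neighbourhood G z) > 0" "card (neighbourhood H b) > 0"
    using step assms(5) finite_neighbourhood[OF assms(1)] finite_neighbourhood[OF assms(2)]
    by (auto simp: card_gt_0_iff)
  \<comment> \<open>The stationary coordinate contributes \<open>ln |N(b)|\<close> twice with sign
    plus and twice with sign minus.\<close>
  have "step_cost (G \<times>\<^sub>g H) (y, b) (z, b) = step_cost G y z"
    using pos unfolding step_cost_def neighbourhood_direct_prod Times_Int_Times
    by (simp add: card_cartesian_product ln_mult)
  then show ?case using chain.step[OF step.IH, of "(z, b)"] step assms(4,5)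
    by (auto simp: neighbourhood_direct_prod)
qed

lemma chain_iso:
  assumes "is_graph G" "is_graph H" "graph_iso f G H" "chain G x y c"
  shows "chain H (f x) (f y) c"
proof -
  have V: "f ` pverts G = pverts H" "inj_on f (pverts G)"
    using assms(3) unfolding graph_iso_def bij_betw_def by auto
  have nb: "neighbourhood H (f u) = f ` neighbourhood G u" if "u \<in> pverts G" for u
  proof -
    have "(u, v) \<in> parcs G \<longleftrightarrow> (f u, f v) \<in> parcs H" if "v \<in> pverts G" for v
      using assms(3) \<open>u \<in> pverts G\<close> that unfolding graph_iso_def by blast
    then show ?thesis unfolding neighbourhood_def V(1)[symmetric] by auto
  qed
  have sub: "neighbourhood G u \<subseteq> pverts G" for u unfolding neighbourhood_def by auto
  have inter: "neighbourhood H (f u) \<inter> neighbourhood H (f v) = f ` (neighbourhood G u \<inter> neighbourhood G v)"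
    if "u \<in> pverts G" "v \<in> pverts G" for u v
    using nb that inj_on_image_Int[OF V(2) sub sub] by simp
  have card: "card (f ` A) = card A" if "A \<subseteq> pverts G" for A
    using card_image inj_on_subset[OF V(2) that] by blast
  have cost: "step_cost H (f u) (f v) = step_cost G u v" if "u \<in> pverts G" "v \<in> pverts G" for u v
  proof -
    have "neighbourhood G u \<inter> neighbourhood G v \<subseteq> pverts G" using sub by blast
    then have "card (neighbourhood H (f u) \<inter> neighbourhood H (f v)) =
        card (neighbourhood G u \<inter> neighbourhood G v)"
      using inter[OF that] card by simp
    then show ?thesis unfolding step_cost_def using that by (simp add: nb card sub)
  qed
  show ?thesis using assms(4)
  proof (induction rule: chain.induct)
    case (nil x)
    then show ?case using V nb by (intro chain.nil) auto
  next
    case (step x y c z)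
    have yz: "y \<in> pverts G" "z \<in> pverts G" using chain_verts[OF step(1)] step(2) by auto
    have "neighbourhood H (f y) \<inter> neighbourhood H (f z) \<noteq> {}"
      using inter[OF yz] step by simp
    then show ?case using chain.step[OF step.IH, of "f z"] cost[OF yz] V(1) yz by auto
  qed
qed

lemma graph_iso_swap: "graph_iso prod.swap (G \<times>\<^sub>g H) (H \<times>\<^sub>g G)"
  unfolding graph_iso_def by (auto simp: bij_betw_def inj_on_def image_iff)

text \<open>First the left coordinate moves, then the right one; the second move is the first one in
  the swapped product.\<close>

lemma chain_direct_prod:
  assumes "is_graph G" "is_graph H" "chain G a a' c" "chain H b b' d"
  shows "chain (G \<times>\<^sub>g H) (a, b) (a', b') (c + d)"
proof -
  have "chain (H \<times>\<^sub>g G) (b, a') (b', a') d"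
    using chain_direct_prod_left assms chain_verts by metis
  from chain_iso[OF is_graph_direct_prod is_graph_direct_prod graph_iso_swap this]
  have "chain (G \<times>\<^sub>g H) (a', b) (a', b') d" using assms(1,2) by simp
  moreover have "chain (G \<times>\<^sub>g H) (a, b) (a', b) c"
    using chain_direct_prod_left assms chain_verts by metis
  ultimately show ?thesis by (rule chain_trans)
qed

text \<open>Neighbourhoods in the product are Cartesian products: they meet iff they meet in both
  coordinates, and logarithms turn their cardinalities into sums. So a chain projects step by step
  and its cost splits exactly.\<close>

lemma chain_direct_prodD:
  assumes "is_graph G" "is_graph H" "chain (G \<times>\<^sub>g H) x y e"
  shows "\<exists>c d. chain G (fst x) (fst y) c \<and> chain H (snd x) (snd y) d \<and> e = c + d"
  using assms(3)
proof (induction rule: chain.induct)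
  case (nil x)
  then show ?case using chain.nil[of "fst x" G] chain.nil[of "snd x" H]
    by (cases x) (fastforce simp: neighbourhood_direct_prod)
next
  case (step x y e z)
  obtain y1 y2 z1 z2 where [simp]: "y = (y1, y2)" "z = (z1, z2)" by (cases y; cases z)
  obtain c d where cd: "chain G (fst x) y1 c" "chain H (snd x) y2 d" "e = c + d" using step by auto
  have ne: "neighbourhood G y1 \<inter> neighbourhood G z1 \<noteq> {}"
    "neighbourhood H y2 \<inter> neighbourhood H z2 \<noteq> {}" "z1 \<in> pverts G" "z2 \<in> pverts H"
    using step by (auto simp: neighbourhood_direct_prod Times_Int_Times)
  then have pos: "card (neighbourhood G y1) > 0" "card (neighbourhood G z1) > 0"
    "card (neighbourhood G y1 \<inter> neighbourhood G z1) > 0"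
    "card (neighbourhood H y2) > 0" "card (neighbourhood H z2) > 0"
    "card (neighbourhood H y2 \<inter> neighbourhood H z2) > 0"
    using finite_neighbourhood[OF assms(1)] finite_neighbourhood[OF assms(2)]
    by (auto simp: card_gt_0_iff finite_Int)
  have "step_cost (G \<times>\<^sub>g H) y z = step_cost G y1 z1 + step_cost H y2 z2"
    using pos unfolding step_cost_def
    by (simp add: neighbourhood_direct_prod Times_Int_Times card_cartesian_product ln_mult)
  then show ?case using chain.step[OF cd(1) ne(3,1)] chain.step[OF cd(2) ne(4,2)] cd(3)
    by (fastforce simp: algebra_simps)
qed

lemma linked_direct_prod_iff:
  assumes "is_graph G" "is_graph H"
  shows "linked (G \<times>\<^sub>g H) x y \<longleftrightarrow> linked G (fst x) (fst y) \<and> linked H (snd x) (snd y)"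
  unfolding linked_def
  using chain_direct_prod[OF assms] chain_direct_prodD[OF assms] by (metis prod.collapse)

text \<open>The chains of the two coordinates can be chosen independently, so the infimum of the
  sums is the sum of the infima.\<close>

lemma chain_dist_direct_prod:
  assumes "is_graph G" "is_graph H" "linked (G \<times>\<^sub>g H) x y"
  shows "chain_dist (G \<times>\<^sub>g H) x y = chain_dist G (fst x) (fst y) + chain_dist H (snd x) (snd y)"
proof -
  note GH = is_graph_direct_prod[OF assms(1,2)]
  have l: "linked G (fst x) (fst y)" "linked H (snd x) (snd y)"
    using assms linked_direct_prod_iff by metis+
  have prod: "chain (G \<times>\<^sub>g H) x y (c + d)"
    if "chain G (fst x) (fst y) c" "chain H (snd x) (snd y) d" for c d
    using chain_direct_prod[OF assms(1,2) that] by simp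
  have "chain_dist G (fst x) (fst y) + chain_dist H (snd x) (snd y) \<le> chain_dist (G \<times>\<^sub>g H) x y"
    unfolding chain_dist_def[of "G \<times>\<^sub>g H"]
  proof (rule cInf_greatest)
    show "{c. chain (G \<times>\<^sub>g H) x y c} \<noteq> {}" using assms(3) unfolding linked_def by auto
  next
    fix e assume "e \<in> {c. chain (G \<times>\<^sub>g H) x y c}"
    then obtain c d where "chain G (fst x) (fst y) c" "chain H (snd x) (snd y) d" "e = c + d"
      using chain_direct_prodD[OF assms(1,2)] by blast
    then show "chain_dist G (fst x) (fst y) + chain_dist H (snd x) (snd y) \<le> e"
      using chain_dist_le assms by (metis add_mono)
  qed
  moreover have "chain_dist (G \<times>\<^sub>g H) x y - d \<le> chain_dist G (fst x) (fst y)"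
    if "chain H (snd x) (snd y) d" for d
    unfolding chain_dist_def[of G] using l(1) chain_dist_le[OF GH prod[OF _ that]]
    by (intro cInf_greatest) (auto simp: linked_def algebra_simps)
  then have "chain_dist (G \<times>\<^sub>g H) x y - chain_dist G (fst x) (fst y) \<le> chain_dist H (snd x) (snd y)"
    unfolding chain_dist_def[of H] using l(2)
    by (intro cInf_greatest) (auto simp: linked_def algebra_simps)
  ultimately show ?thesis by simp
qed

lemma
  assumes "is_graph G" "is_graph H" "graph_iso f G H" "x \<in> pverts G" "y \<in> pverts G"
  shows linked_iso: "linked H (f x) (f y) \<longleftrightarrow> linked G x y"
    and chain_dist_iso: "chain_dist H (f x) (f y) = chain_dist G x y"
proof -
  let ?g = "inv_into (pverts G) f"
  have "bij_betw f (pverts G) (pverts H)" using assms(3) unfolding graph_iso_def by blast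
  then have "?g (f x) = x" "?g (f y) = y"
    using bij_betw_inv_into_left[of f "pverts G" "pverts H"] assms(4,5) by blast+
  then have "chain H (f x) (f y) = chain G x y"
    unfolding fun_eq_iff
    using chain_iso[OF assms(1-3)] chain_iso[OF assms(2,1) graph_iso_inv[OF assms(3)]] by metis
  then show "linked H (f x) (f y) \<longleftrightarrow> linked G x y" "chain_dist H (f x) (f y) = chain_dist G x y"
    unfolding linked_def chain_dist_def by simp_all
qed

section \<open>Linked classes of connected graphs\<close>

lemma connected_graph_induct:
  assumes "connected_graph G" "S \<subseteq> pverts G" "S \<noteq> {}"
    and closed: "\<And>u v. u \<in> S \<Longrightarrow> (u, v) \<in> parcs G \<or> (v, u) \<in> parcs G \<Longrightarrow> v \<in> S"
  shows "S = pverts G"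
proof -
  obtain u where u: "u \<in> S" using assms by blast
  have "v \<in> S" if "v \<in> pverts G" for v
  proof -
    have "(u, v) \<in> rtrancl_on (pverts G) (parcs (mk_symmetric (with_proj G)))"
      using assms(1,2) u that
      unfolding connected_graph_def connected_def strongly_connected_def reachable_def by auto
    then show ?thesis
      by (induction rule: rtrancl_on_induct) (use u closed in \<open>auto simp: parcs_mk_symmetric\<close>)
  qed
  then show ?thesis using assms(2) by blast
qed

text \<open>Crossing an edge exchanges the vertices linked to \<open>u\<close> with those linked to
  \<open>v\<close>, so the union of both classes is closed under adjacency.\<close>

lemma connected_linked_to_edge:
  assumes "is_graph G" "connected_graph G" "(u, v) \<in> parcs G" "x \<in> pverts G"
  shows "linked G u x \<or> linked G v x"
proof -
  let ?S = "{x. linked G u x \<or> linked G v x}"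
  have uv: "u \<in> pverts G" "v \<in> pverts G" "(v, u) \<in> parcs G" using assms is_graphD by metis+
  then have "linked G u u" using assms by (intro linked_refl) (auto simp: neighbourhood_def)
  moreover have "b \<in> ?S" if "a \<in> ?S" "(a, b) \<in> parcs G \<or> (b, a) \<in> parcs G" for a b
  proof -
    have "(a, b) \<in> parcs G" using that assms is_graphD by metis
    then show ?thesis using that(1) linked_neighbours[OF assms(1)] assms(3) uv by blast
  qed
  ultimately have "?S = pverts G"
    using linked_verts[of G] by (intro connected_graph_induct[OF assms(2)]) auto
  then show ?thesis using assms(4) by blast
qed

text \<open>Every edge joins the linked classes of the ends of a fixed edge. If these were disjoint
  they would form a bipartition; hence they share a vertex and coincide. The fixed edge exists
  because an edgeless graph is bipartite with an empty side.\<close>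

lemma connected_nonbipartite_linked:
  assumes G: "is_graph G" "connected_graph G" "\<not> bipartite G" and "x \<in> pverts G" "y \<in> pverts G"
  shows "linked G x y"
proof -
  have "parcs G \<noteq> {}"
  proof
    assume "parcs G = {}"
    then have "bipartition G (pverts G) {}" unfolding bipartition_def by auto
    then show False using G unfolding bipartite_def by blast
  qed
  then obtain u v where uv: "(u, v) \<in> parcs G" by auto
  let ?A = "{x. linked G u x}" and ?B = "{x. linked G v x}"
  have un: "?A \<union> ?B = pverts G"
    using connected_linked_to_edge[OF G(1,2) uv] linked_verts[of G] by auto
  have "a \<in> ?A \<and> b \<in> ?B \<or> a \<in> ?B \<and> b \<in> ?A" if ab: "(a, b) \<in> parcs G" for a b
  proof -
    have "a \<in> ?A \<union> ?B" using is_graphD(2)[OF G(1) ab] un by simp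
    then show ?thesis
      using linked_neighbours[OF G(1) _ uv ab]
        linked_neighbours[OF G(1) _ is_graphD(4)[OF G(1) uv] ab] by auto
  qed
  then have "bipartition G ?A ?B" if "?A \<inter> ?B = {}" using that un unfolding bipartition_def by blast
  then obtain z where "linked G u z" "linked G v z" using G(3) unfolding bipartite_def by blast
  then have uv_linked: "linked G u v" using linked_sym linked_trans by metis
  have "linked G u w" if "w \<in> pverts G" for w
  proof -
    have "w \<in> ?A \<union> ?B" using un that by simp
    then show ?thesis using linked_trans[OF uv_linked] by auto
  qed
  then show ?thesis using assms linked_sym linked_trans by metis
qed

section \<open>Prime factors under an isomorphism of products\<close>

text \<open>There are two operations because the ends of an arc of a product
  \<open>G \<times>\<^sub>g H\<close> may lie in the copies of \<open>G\<close> over different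
  vertices of \<open>H\<close>, each with its own band.\<close>

definition arc_compatible :: "'a graph \<Rightarrow> ('a \<Rightarrow> 'a \<Rightarrow> 'a) \<Rightarrow> ('a \<Rightarrow> 'a \<Rightarrow> 'a) \<Rightarrow> bool" where
  "arc_compatible G E F \<longleftrightarrow>
     (\<forall>x x' y y'. (x, x') \<in> parcs G \<longrightarrow> (y, y') \<in> parcs G \<longrightarrow> (E x y, F x' y') \<in> parcs G)"

lemma arc_compatibleD:
  "arc_compatible G E F \<Longrightarrow> (x, x') \<in> parcs G \<Longrightarrow> (y, y') \<in> parcs G \<Longrightarrow> (E x y, F x' y') \<in> parcs G"
  unfolding arc_compatible_def by blast

lemma arc_compatible_sym: "is_graph G \<Longrightarrow> arc_compatible G E F \<Longrightarrow> arc_compatible G F E"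
  unfolding arc_compatible_def using is_graphD(4) by metis

text \<open>A band compatible with itself factors \<open>G\<close> into its images under
  \<open>E _ c\<close> and \<open>E c _\<close> for a base vertex \<open>c\<close>. Primality
  shrinks one of them to a single vertex, and then \<open>E\<close> is a projection.\<close>

lemma prime_graph_band_trivial:
  assumes prime: "prime_graph G" and E: "rectangular_band (pverts G) E" "arc_compatible G E E"
  shows "(\<forall>x\<in>pverts G. \<forall>y\<in>pverts G. E x y = x) \<or> (\<forall>x\<in>pverts G. \<forall>y\<in>pverts G. E x y = y)"
proof -
  interpret E: rectangular_band "pverts G" E by (rule E(1))
  have G: "is_graph G" and "card (pverts G) > 1" using prime unfolding prime_graph_def by auto
  then obtain c where c: "c \<in> pverts G" by fastforce
  \<comment> \<open>The arcs of the factors are images of arcs of \<open>G\<close>, not induced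
    ones: for an arc \<open>(x, y)\<close>, the pair \<open>(E x c, E y c)\<close> need not be an
    arc of \<open>G\<close>, since \<open>c\<close> need not carry a loop.\<close>
  define A where "A = \<lparr>pverts = {x \<in> pverts G. E x c = x},
    parcs = (\<lambda>(x, y). (E x c, E y c)) ` parcs G\<rparr>"
  define B where "B = \<lparr>pverts = {x \<in> pverts G. E c x = x},
    parcs = (\<lambda>(x, y). (E c x, E c y)) ` parcs G\<rparr>"
  define f where "f x = (E x c, E c x)" for x
  have verts: "pverts A = {x \<in> pverts G. E x c = x}" "pverts B = {x \<in> pverts G. E c x = x}"
    unfolding A_def B_def by simp_all
  have arcsA: "(a, a') \<in> parcs A \<longleftrightarrow> (\<exists>x x'. (x, x') \<in> parcs G \<and> a = E x c \<and> a' = E x' c)" for a a'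
    unfolding A_def by force
  have arcsB: "(b, b') \<in> parcs B \<longleftrightarrow> (\<exists>x x'. (x, x') \<in> parcs G \<and> b = E c x \<and> b' = E c x')" for b b'
    unfolding B_def by force
  have mix: "E (E x c) (E c y) = E x y" if "x \<in> pverts G" "y \<in> pverts G" for x y
    using that c by (simp add: E.closed E.left E.right)
  have fst_mix: "E (E x y) c = E x c" "E c (E x y) = E c y" if "x \<in> pverts G" "y \<in> pverts G" for x y
    using that c by (simp_all add: E.closed E.left E.right)
  have A: "is_graph A"
    unfolding is_graph_iff sym_def subset_iff
    using is_graphD[OF G] c by (auto simp: arcsA verts E.closed E.left E.idem) blast
  have B: "is_graph B"
    unfolding is_graph_iff sym_def subset_iff
    using is_graphD[OF G] c by (auto simp: arcsB verts E.closed E.right E.idem) blast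
  have "bij_betw f (pverts G) (pverts (A \<times>\<^sub>g B))"
  proof (rule bij_betw_byWitness[where f' = "\<lambda>(a, b). E a b"])
    show "\<forall>x\<in>pverts G. (case f x of (a, b) \<Rightarrow> E a b) = x"
      unfolding f_def using mix E.idem by simp
    show "\<forall>p\<in>pverts (A \<times>\<^sub>g B). f (case p of (a, b) \<Rightarrow> E a b) = p"
      unfolding f_def by (auto simp: verts fst_mix)
    show "f ` pverts G \<subseteq> pverts (A \<times>\<^sub>g B)"
      unfolding f_def using c by (auto simp: verts E.closed E.left E.right E.idem)
    show "(\<lambda>(a, b). E a b) ` pverts (A \<times>\<^sub>g B) \<subseteq> pverts G"
      by (auto simp: verts E.closed)
  qed
  moreover have "(x, y) \<in> parcs G \<longleftrightarrow> (f x, f y) \<in> parcs (A \<times>\<^sub>g B)"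
    if xy: "x \<in> pverts G" "y \<in> pverts G" for x y
  proof
    assume "(x, y) \<in> parcs G"
    then show "(f x, f y) \<in> parcs (A \<times>\<^sub>g B)" unfolding f_def by (auto simp: arcsA arcsB)
  next
    assume "(f x, f y) \<in> parcs (A \<times>\<^sub>g B)"
    \<comment> \<open>The two coordinates come from two unrelated arcs of \<open>G\<close>;
      compatibility recombines them into the arc \<open>(x, y)\<close>.\<close>
    then obtain u u' v v' where uv: "(u, u') \<in> parcs G" "(v, v') \<in> parcs G"
      and eq: "E x c = E u c" "E y c = E u' c" "E c x = E c v" "E c y = E c v'"
      unfolding f_def by (auto simp: arcsA arcsB)
    have V: "u \<in> pverts G" "u' \<in> pverts G" "v \<in> pverts G" "v' \<in> pverts G"
      using uv is_graphD(2,3)[OF G] by blast+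
    have "E u v = x" "E u' v' = y"
      using mix[of u v] mix[of u' v'] mix[of x x] mix[of y y] eq V xy by (simp_all add: E.idem)
    then show "(x, y) \<in> parcs G" using arc_compatibleD[OF E(2) uv] by simp
  qed
  ultimately have f: "graph_iso f G (A \<times>\<^sub>g B)" unfolding graph_iso_def by blast
  obtain g A' where A': "is_graph (A' :: nat graph)" "graph_iso g A A'"
    using ex_nat_graph_iso[OF A] by blast
  obtain h B' where B': "is_graph (B' :: nat graph)" "graph_iso h B B'"
    using ex_nat_graph_iso[OF B] by blast
  have "G \<simeq>\<^sub>g A' \<times>\<^sub>g B'"
    using graph_iso_comp[OF f graph_iso_direct_prod[OF A'(2) B'(2)]]
      isomorphic_iff_graph_iso[OF G is_graph_direct_prod[OF A'(1) B'(1)]] by blast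
  then have "card (pverts A') = 1 \<or> card (pverts B') = 1"
    using prime A' B' unfolding prime_graph_def by blast
  then have cards: "card (pverts A) = 1 \<or> card (pverts B) = 1"
    using graph_iso_card[OF A'(2)] graph_iso_card[OF B'(2)] by simp
  have c_in: "c \<in> pverts A" "c \<in> pverts B" using c by (auto simp: verts E.idem)
  show ?thesis using cards
  proof
    assume "card (pverts A) = 1"
    then have "pverts A = {c}" using c_in by (auto simp: card_1_singleton_iff)
    then have "E x c = c" if "x \<in> pverts G" for x
      using that c E.closed E.left E.idem unfolding verts by blast
    then have "E x y = y" if "x \<in> pverts G" "y \<in> pverts G" for x y
      using mix[of x y] mix[of y y] that by (simp add: E.idem)
    then show ?thesis by blast
  next
    assume "card (pverts B) = 1"
    then have "pverts B = {c}" using c_in by (auto simp: card_1_singleton_iff)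
    then have "E c x = c" if "x \<in> pverts G" for x
      using that c E.closed E.right E.idem unfolding verts by blast
    then have "E x y = x" if "x \<in> pverts G" "y \<in> pverts G" for x y
      using mix[of x y] mix[of x x] that by (simp add: E.idem)
    then show ?thesis by blast
  qed
qed

text \<open>Sort the four coordinates of \<open>V\<close> by the arguments from which
  \<open>E\<close> and \<open>F\<close> take them. The coordinate that both take from the first
  argument, and the one that both take from the second, are each singled out by a band compatible
  with itself, so by primality each is everything or nothing. If both are nothing,
  \<open>E y x = F x y\<close>, and an arc produces a loop.\<close>

lemma prime_loopless_bands_trivial:
  assumes G: "prime_graph G" "loopless G" "parcs G \<noteq> {}"
    and EF: "commuting_bands (pverts G) E F" "arc_compatible G E F"
  shows "(\<forall>x\<in>pverts G. \<forall>y\<in>pverts G. E x y = x \<and> F x y = x) \<or>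
    (\<forall>x\<in>pverts G. \<forall>y\<in>pverts G. E x y = y \<and> F x y = y)"
proof -
  let ?V = "pverts G"
  interpret commuting_bands ?V E F by (rule EF(1))
  interpret op: commuting_bands ?V "\<lambda>x y. E y x" "\<lambda>x y. F y x"
    using rectangular_band_opposite[OF E.rectangular_band_axioms]
      rectangular_band_opposite[OF F.rectangular_band_axioms] commute
    by (simp add: commuting_bands_def commuting_bands_axioms_def)
  have graph: "is_graph G" using G(1) unfolding prime_graph_def by blast
  note FE = arc_compatible_sym[OF graph EF(2)]
  have arcs: "x \<in> ?V" "x' \<in> ?V" if "(x, x') \<in> parcs G" for x x'
    using that is_graphD(2,3)[OF graph] by blast+
  have "arc_compatible G (\<lambda>x y. E (F x y) y) (\<lambda>x y. E (F x y) y)"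
    unfolding arc_compatible_def
  proof (intro allI impI)
    fix x x' y y' assume xy: "(x, x') \<in> parcs G" "(y, y') \<in> parcs G"
    \<comment> \<open>Compatibility of \<open>(F, E)\<close> followed by that of
      \<open>(E, F)\<close> nests the operations in opposite orders at the two ends; commuting makes
      both ends the same band.\<close>
    have "(E (F x y) y, F (E x' y') y') \<in> parcs G"
      using arc_compatibleD[OF EF(2) arc_compatibleD[OF FE xy] xy(2)] .
    then show "(E (F x y) y, E (F x' y') y') \<in> parcs G"
      using meet_commute[of x' y'] arcs xy by simp
  qed
  from prime_graph_band_trivial[OF G(1) meet_band this]
  have 1: "(\<forall>x\<in>?V. \<forall>y\<in>?V. E (F x y) y = x) \<or> (\<forall>x\<in>?V. \<forall>y\<in>?V. E (F x y) y = y)" .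
  have "arc_compatible G (\<lambda>x y. E y (F y x)) (\<lambda>x y. E y (F y x))"
    unfolding arc_compatible_def
  proof (intro allI impI)
    fix x x' y y' assume xy: "(x, x') \<in> parcs G" "(y, y') \<in> parcs G"
    have "(E y (F y x), F y' (E y' x')) \<in> parcs G"
      using arc_compatibleD[OF EF(2) xy(2) arc_compatibleD[OF FE xy(2,1)]] .
    then show "(E y (F y x), E y' (F y' x')) \<in> parcs G"
      using op.meet_commute[of x' y'] arcs xy by simp
  qed
  from prime_graph_band_trivial[OF G(1) op.meet_band this]
  have 2: "(\<forall>x\<in>?V. \<forall>y\<in>?V. E x (F x y) = y) \<or> (\<forall>x\<in>?V. \<forall>y\<in>?V. E x (F x y) = x)" by blast
  consider "\<forall>x\<in>?V. \<forall>y\<in>?V. E (F x y) y = x" | "\<forall>x\<in>?V. \<forall>y\<in>?V. E x (F x y) = y"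
    | "\<forall>x\<in>?V. \<forall>y\<in>?V. E (F x y) y = y" "\<forall>x\<in>?V. \<forall>y\<in>?V. E x (F x y) = x"
    using 1 2 by blast
  then show ?thesis
  proof cases
    case 1
    have "E x y = x \<and> F x y = x" if "x \<in> ?V" "y \<in> ?V" for x y
      using that 1 meet_commute[OF that] E.left[of "F x y" y y] F.left[of "E x y" y y]
      by (simp add: E.closed F.closed)
    then show ?thesis by blast
  next
    case 2
    have "E x y = y \<and> F x y = y" if "x \<in> ?V" "y \<in> ?V" for x y
      using that 2 op.meet_commute[of y x] E.right[of x x "F x y"] F.right[of x x "E x y"]
      by (simp add: E.closed F.closed)
    then show ?thesis by blast
  next
    case 3
    obtain x y where xy: "(x, y) \<in> parcs G" using G(3) by auto
    note V = arcs[OF xy]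
    have "E y x = E (E (F x y) y) (E x (F x y))" using 3 V by simp
    \<comment> \<open>By the case assumptions \<open>y\<close> and \<open>x\<close> were rewritten
      as values of \<open>E\<close>, and the band laws now cancel everything but
      \<open>F x y\<close>.\<close>
    also have "\<dots> = F x y" using V by (simp add: E.closed F.closed E.left E.right E.idem)
    finally have "(E y x, E y x) \<in> parcs G"
      using arc_compatibleD[OF EF(2) is_graphD(4)[OF graph xy] xy] by simp
    then show ?thesis using G(2) arcs(1) unfolding loopless_def by blast
  qed
qed

section \<open>Two product structures on one vertex set\<close>

lemma pseudometric_on_chain_dist:
  assumes G: "is_graph G" and linked: "\<And>x y. x \<in> X \<Longrightarrow> y \<in> X \<Longrightarrow> linked G (f x) (f y)"
  shows "pseudometric_on X (\<lambda>x y. chain_dist G (f x) (f y))"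
  unfolding pseudometric_on_def
  using chain_dist_nonneg[OF G linked] chain_dist_sym[OF G] chain_dist_triangle[OF G linked linked]
    chain_dist_self[OF G linked] by auto

text \<open>Used with \<open>K\<close> = \<Gamma>, \<open>L\<close> = \<Sigma>, \<open>G\<close> a
  prime factor of \<Gamma>, \<open>H\<close> the product of \<Sigma> with the other factors of
  \<Gamma>, and \<open>F\<close> the automorphism read through the factorization. As
  \<open>H\<close> may be bipartite, its vertices are only required to be linked to one end of a
  fixed edge.\<close>

locale factor_iso =
  fixes G :: "'g graph" and H :: "'h graph" and K :: "'k graph" and L :: "'l graph" and F h0 h1
  assumes graphs: "is_graph G" "is_graph H" "is_graph K" "is_graph L"
    and prime: "prime_graph G" and loopless: "loopless G"
    and twin_free: "twin_free K" "twin_free L"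
    and iso: "graph_iso F (G \<times>\<^sub>g H) (K \<times>\<^sub>g L)"
    and linked_G: "\<And>x y. x \<in> pverts G \<Longrightarrow> y \<in> pverts G \<Longrightarrow> linked G x y"
    and linked_K: "\<And>x y. x \<in> pverts K \<Longrightarrow> y \<in> pverts K \<Longrightarrow> linked K x y"
    and edge: "(h0, h1) \<in> parcs H"
    and linked_H: "\<And>h. h \<in> pverts H \<Longrightarrow> linked H h0 h \<or> linked H h1 h"
begin

lemma product_graphs: "is_graph (G \<times>\<^sub>g H)" "is_graph (K \<times>\<^sub>g L)"
  using graphs is_graph_direct_prod by blast+

definition F' where "F' = inv_into (pverts G \<times> pverts H) F"

lemma F: "bij_betw F (pverts G \<times> pverts H) (pverts K \<times> pverts L)"
  using iso unfolding graph_iso_def by simp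

lemma F_in: "x \<in> pverts G \<times> pverts H \<Longrightarrow> F x \<in> pverts K \<times> pverts L"
  using bij_betwE[OF F] by blast

lemma F'_in: "y \<in> pverts K \<times> pverts L \<Longrightarrow> F' y \<in> pverts G \<times> pverts H"
  unfolding F'_def using bij_betwE[OF bij_betw_inv_into[OF F]] by blast

lemma F_F': "y \<in> pverts K \<times> pverts L \<Longrightarrow> F (F' y) = y"
  unfolding F'_def using bij_betw_inv_into_right[OF F] by blast

lemma F'_F: "x \<in> pverts G \<times> pverts H \<Longrightarrow> F' (F x) = x"
  unfolding F'_def using bij_betw_inv_into_left[OF F] by blast

lemma F_arc: "x \<in> pverts G \<times> pverts H \<Longrightarrow> y \<in> pverts G \<times> pverts H \<Longrightarrow>
    (F x, F y) \<in> parcs (K \<times>\<^sub>g L) \<longleftrightarrow> (x, y) \<in> parcs (G \<times>\<^sub>g H)"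
  using iso unfolding graph_iso_def direct_prod_simps(1) by blast

lemma F_linked: "x \<in> pverts G \<times> pverts H \<Longrightarrow> y \<in> pverts G \<times> pverts H \<Longrightarrow>
    linked (K \<times>\<^sub>g L) (F x) (F y) \<longleftrightarrow> linked (G \<times>\<^sub>g H) x y"
  using linked_iso[OF product_graphs iso] by simp

lemma linked_H_self: "h \<in> pverts H \<Longrightarrow> linked H h h"
  using linked_H linked_sym linked_trans by metis

text \<open>Chain distances are meaningful only between linked vertices, so the work takes place
  inside one linked class. As all of \<open>G\<close> is linked, \<open>X h\<close> is the class
  containing the copy of \<open>G\<close> over \<open>h\<close>. On it \<open>P\<close>,
  \<open>Q\<close> and \<open>R\<close>, \<open>S\<close> are the coordinate distances of the two
  product structures.\<close>

definition X where "X h = pverts G \<times> {h'. linked H h h'}"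
definition P :: "'g \<times> 'h \<Rightarrow> 'g \<times> 'h \<Rightarrow> real" where "P x y = chain_dist G (fst x) (fst y)"
definition Q :: "'g \<times> 'h \<Rightarrow> 'g \<times> 'h \<Rightarrow> real" where "Q x y = chain_dist H (snd x) (snd y)"
definition R where "R x y = chain_dist K (fst (F x)) (fst (F y))"
definition S where "S x y = chain_dist L (snd (F x)) (snd (F y))"

lemma X_sub: "X h \<subseteq> pverts G \<times> pverts H"
  unfolding X_def using linked_verts[of H] by auto

lemma X_linked:
  assumes "x \<in> X h" "y \<in> X h"
  shows "linked G (fst x) (fst y)" "linked H (snd x) (snd y)" "linked (G \<times>\<^sub>g H) x y"
    "linked K (fst (F x)) (fst (F y))" "linked L (snd (F x)) (snd (F y))"
proof -
  show 1: "linked G (fst x) (fst y)" using assms linked_G unfolding X_def by auto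
  show 2: "linked H (snd x) (snd y)"
    using assms linked_trans[OF linked_sym, of H h "snd x" "snd y"] unfolding X_def by auto
  show 3: "linked (G \<times>\<^sub>g H) x y"
    using 1 2 linked_direct_prod_iff[OF graphs(1,2)] by blast
  have "linked (K \<times>\<^sub>g L) (F x) (F y)" using 3 F_linked X_sub assms by blast
  then show "linked K (fst (F x)) (fst (F y))" "linked L (snd (F x)) (snd (F y))"
    using linked_direct_prod_iff[OF graphs(3,4)] by blast+
qed

lemma X_I: "x \<in> X h \<Longrightarrow> linked (G \<times>\<^sub>g H) x y \<Longrightarrow> y \<in> X h"
  unfolding X_def using linked_direct_prod_iff[OF graphs(1,2), of x y]
    linked_trans[of H h "snd x" "snd y"] linked_verts[of G "fst x" "fst y"]
  by (simp add: mem_Times_iff)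

lemma total:
  assumes "x \<in> X h" "y \<in> X h"
  shows "P x y + Q x y = chain_dist (G \<times>\<^sub>g H) x y" "R x y + S x y = chain_dist (G \<times>\<^sub>g H) x y"
proof -
  have V: "x \<in> pverts (G \<times>\<^sub>g H)" "y \<in> pverts (G \<times>\<^sub>g H)" using X_sub assms by auto
  show "P x y + Q x y = chain_dist (G \<times>\<^sub>g H) x y"
    unfolding P_def Q_def using chain_dist_direct_prod[OF graphs(1,2) X_linked(3)[OF assms]] by simp
  have "linked (K \<times>\<^sub>g L) (F x) (F y)"
    using linked_direct_prod_iff[OF graphs(3,4)] X_linked(4,5)[OF assms] by blast
  then show "R x y + S x y = chain_dist (G \<times>\<^sub>g H) x y"
    unfolding R_def S_def chain_dist_iso[OF product_graphs iso V, symmetric]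
    using chain_dist_direct_prod[OF graphs(3,4)] by simp
qed

lemma RS_eq_0:
  assumes "x \<in> X h" "y \<in> X h"
  shows "R x y = 0 \<longleftrightarrow> fst (F x) = fst (F y)" "S x y = 0 \<longleftrightarrow> snd (F x) = snd (F y)"
  using chain_dist_eq_0[OF graphs(3) twin_free(1) X_linked(4)[OF assms]]
    chain_dist_eq_0[OF graphs(4) twin_free(2) X_linked(5)[OF assms]]
    chain_dist_self[OF graphs(3), of "fst (F x)"] chain_dist_self[OF graphs(4), of "snd (F x)"]
    X_linked(4,5)[OF assms(1,1)]
  unfolding R_def S_def by auto

lemma eq_if_total_0:
  assumes "x \<in> X h" "y \<in> X h" "P x y + Q x y = 0" shows "x = y"
proof -
  have "R x y + S x y = 0" using total assms by metis
  moreover have "R x y \<ge> 0" "S x y \<ge> 0"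
    unfolding R_def S_def
    using chain_dist_nonneg[OF graphs(3) X_linked(4)[OF assms(1,2)]]
      chain_dist_nonneg[OF graphs(4) X_linked(5)[OF assms(1,2)]] by simp_all
  ultimately have "R x y = 0" "S x y = 0" by linarith+
  then have "F x = F y" using RS_eq_0[OF assms(1,2)] by (simp add: prod_eq_iff)
  then show ?thesis using F'_F[of x] F'_F[of y] X_sub assms by auto
qed

text \<open>Twin-freeness is given for \<open>K\<close> and \<open>L\<close>, so separation is first
  obtained for the total metric. If \<open>P x y = 0\<close>, then \<open>x\<close> and the vertex
  with the \<open>G\<close>-coordinate of \<open>y\<close> and the \<open>H\<close>-coordinate of
  \<open>x\<close> are at total distance 0, hence equal; likewise for \<open>Q\<close>.\<close>

lemma PQ_eq_0:
  assumes "x \<in> X h" "y \<in> X h"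
  shows "P x y = 0 \<longleftrightarrow> fst x = fst y" "Q x y = 0 \<longleftrightarrow> snd x = snd y"
proof -
  have 0: "P u v = 0" if "fst u = fst v" "u \<in> X h" "v \<in> X h" for u v
    using that chain_dist_self[OF graphs(1) X_linked(1)[OF that(2,2)]] unfolding P_def by simp
  have 1: "Q u v = 0" if "snd u = snd v" "u \<in> X h" "v \<in> X h" for u v
    using that chain_dist_self[OF graphs(2) X_linked(2)[OF that(2,2)]] unfolding Q_def by simp
  have m: "(fst x, snd y) \<in> X h" "(fst y, snd x) \<in> X h" using assms unfolding X_def by auto
  show "P x y = 0 \<longleftrightarrow> fst x = fst y"
  proof
    assume "P x y = 0"
    then have "P x (fst y, snd x) = 0" unfolding P_def by simp
    then have "x = (fst y, snd x)" using eq_if_total_0[OF assms(1) m(2)] 1[OF _ assms(1) m(2)] by simp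
    then show "fst x = fst y" by (metis fst_conv)
  qed (use 0 assms in blast)
  show "Q x y = 0 \<longleftrightarrow> snd x = snd y"
  proof
    assume "Q x y = 0"
    then have "Q x (fst x, snd y) = 0" unfolding Q_def by simp
    then have "x = (fst x, snd y)" using eq_if_total_0[OF assms(1) m(1)] 0[OF _ assms(1) m(1)] by simp
    then show "snd x = snd y" by (metis snd_conv)
  qed (use 1 assms in blast)
qed

text \<open>A linked class of a product is a product of linked classes, so it is closed under mixing
  of either product structure.\<close>

lemma mix_in_X:
  assumes "x \<in> X h" "y \<in> X h"
  shows "(fst x, snd y) \<in> X h" "F' (fst (F x), snd (F y)) \<in> X h"
    "F (F' (fst (F x), snd (F y))) = (fst (F x), snd (F y))"
proof -
  show "(fst x, snd y) \<in> X h" using assms unfolding X_def by auto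
  have in_X: "x \<in> pverts G \<times> pverts H" "y \<in> pverts G \<times> pverts H" using assms X_sub by blast+
  let ?z = "(fst (F x), snd (F y))"
  have z: "?z \<in> pverts K \<times> pverts L" using F_in[OF in_X(1)] F_in[OF in_X(2)] by auto
  show Fz: "F (F' ?z) = ?z" using F_F'[OF z] .
  have "linked (K \<times>\<^sub>g L) (F x) ?z"
    using linked_direct_prod_iff[OF graphs(3,4)] X_linked(4)[OF assms(1,1)] X_linked(5)[OF assms]
    by simp
  then have "linked (G \<times>\<^sub>g H) x (F' ?z)" using F_linked[OF in_X(1) F'_in[OF z]] Fz by simp
  then show "F' ?z \<in> X h" using X_I assms by blast
qed

lemma splittings: "two_l1_splittings (X h) P Q R S"
proof unfold_locales
  have pseudo: "pseudometric_on (X h) P" "pseudometric_on (X h) Q"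
    "pseudometric_on (X h) R" "pseudometric_on (X h) S"
    unfolding P_def[abs_def] Q_def[abs_def] R_def[abs_def] S_def[abs_def]
    by (intro pseudometric_on_chain_dist graphs X_linked; assumption)+
  have "\<exists>z\<in>X h. P x z = 0 \<and> Q z y = 0" if "x \<in> X h" "y \<in> X h" for x y
    using PQ_eq_0(1)[OF that(1) mix_in_X(1)[OF that]] PQ_eq_0(2)[OF mix_in_X(1)[OF that] that(2)]
    by (intro bexI[OF _ mix_in_X(1)[OF that]]) simp
  then show "l1_split (X h) P Q" unfolding l1_split_def using pseudo eq_if_total_0 by blast
  have "\<exists>z\<in>X h. R x z = 0 \<and> S z y = 0" if "x \<in> X h" "y \<in> X h" for x y
    using RS_eq_0(1)[OF that(1) mix_in_X(2)[OF that]] RS_eq_0(2)[OF mix_in_X(2)[OF that] that(2)]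
    by (intro bexI[OF _ mix_in_X(2)[OF that]]) (simp add: mix_in_X(3)[OF that])
  moreover have "x = y" if "x \<in> X h" "y \<in> X h" "R x y + S x y = 0" for x y
    using eq_if_total_0[OF that(1,2)] total[OF that(1,2)] that(3) by simp
  ultimately show "l1_split (X h) R S" unfolding l1_split_def using pseudo by blast
  show "P x y + Q x y = R x y + S x y" if "x \<in> X h" "y \<in> X h" for x y
    using total[OF that] by simp
qed

lemma mixPQ: assumes "x \<in> X h" "y \<in> X h" shows "mix (X h) P Q x y = (fst x, snd y)"
proof -
  interpret two_l1_splittings "X h" P Q R S by (rule splittings)
  show ?thesis
    using assms mix_in_X(1)[OF assms] PQ_eq_0[of x h "(fst x, snd y)"] PQ_eq_0[of "(fst x, snd y)" h y]
    by (intro S.mix_eqI) auto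
qed

lemma mixRS:
  assumes "x \<in> X h" "y \<in> X h" shows "mix (X h) R S x y = F' (fst (F x), snd (F y))"
proof -
  interpret two_l1_splittings "X h" P Q R S by (rule splittings)
  let ?z = "F' (fst (F x), snd (F y))"
  show ?thesis
    using assms mix_in_X(2,3)[OF assms] RS_eq_0[of x h ?z] RS_eq_0[of ?z h y]
    by (intro T.mix_eqI) auto
qed

text \<open>Convexity of the fibres of each product structure with respect to the other one.\<close>

lemma mixRS_fst:
  assumes "x \<in> X h" "y \<in> X h" "fst x = fst y" shows "fst (F' (fst (F x), snd (F y))) = fst x"
proof -
  interpret two_l1_splittings "X h" R S Q P
    using two_l1_splittings.variants[OF splittings, of h] two_l1_splittings.variants by blast
  have "P x (mix (X h) R S x y) = 0"
    using s_convex[OF assms(1,2)] PQ_eq_0(1)[OF assms(1,2)] assms(3) by blast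
  then show ?thesis using PQ_eq_0(1)[OF assms(1) mix_in_X(2)[OF assms(1,2)]] mixRS[OF assms(1,2)] by simp
qed

lemma mixRS_snd_cong:
  assumes "x \<in> X h" "x' \<in> X h" "y \<in> X h" "y' \<in> X h" "snd x = snd x'" "snd y = snd y'"
  shows "snd (F' (fst (F x), snd (F y))) = snd (F' (fst (F x'), snd (F y')))"
proof -
  interpret two_l1_splittings "X h" R S P Q
    using two_l1_splittings.variants[OF splittings, of h] by blast
  have "Q (mix (X h) R S x y) (mix (X h) R S x' y') = 0"
    using s_mix_cong[OF assms(1-4)] PQ_eq_0(2)[OF assms(1,2)] PQ_eq_0(2)[OF assms(3,4)] assms(5,6)
    by blast
  then show ?thesis
    using PQ_eq_0(2)[OF mix_in_X(2)[OF assms(1,3)] mix_in_X(2)[OF assms(2,4)]]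
      mixRS[OF assms(1,3)] mixRS[OF assms(2,4)] by simp
qed

lemma mixRS_snd:
  assumes "x \<in> X h" "y \<in> X h" "snd x = snd y" shows "snd (F' (fst (F x), snd (F y))) = snd x"
  using mixRS_snd_cong[OF assms(1,1,2,1) refl assms(3)[symmetric]] F'_F X_sub assms(1)
  by (metis prod.collapse subsetD)

text \<open>\<open>(g, h')\<close> and \<open>(g', h')\<close> arise from \<open>(g, h)\<close> and
  \<open>(g', h)\<close> by mixing with the one vertex \<open>(g, h')\<close>, and mixing respects
  equality of \<open>K\<close>-coordinates. So a coincidence over \<open>h\<close> spreads to the
  whole linked class of \<open>h\<close>.\<close>

lemma F_fst_indep:
  assumes "g \<in> pverts G" "g' \<in> pverts G" "linked H h h'" "fst (F (g, h)) = fst (F (g', h))"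
  shows "fst (F (g, h')) = fst (F (g', h'))"
proof -
  interpret two_l1_splittings "X h" P Q S R
    using two_l1_splittings.variants[OF splittings, of h] by blast
  have hh: "linked H h h" using assms linked_verts linked_H_self by metis
  have X: "(g, h) \<in> X h" "(g', h) \<in> X h" "(g, h') \<in> X h" "(g', h') \<in> X h"
    using assms hh unfolding X_def by auto
  have "R (g, h) (g', h) = 0" using RS_eq_0(1)[OF X(1,2)] assms(4) by blast
  then have "R (mix (X h) P Q (g, h) (g, h')) (mix (X h) P Q (g', h) (g, h')) = 0"
    using s_mix_cong_left X by blast
  then show ?thesis using mixPQ[OF X(1,3)] mixPQ[OF X(2,3)] RS_eq_0(1)[OF X(3,4)] by simp
qed

lemma F_snd_indep:
  assumes "g \<in> pverts G" "g' \<in> pverts G" "linked H h h'" "snd (F (g, h)) = snd (F (g', h))"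
  shows "snd (F (g, h')) = snd (F (g', h'))"
proof -
  interpret two_l1_splittings "X h" P Q R S by (rule splittings)
  have hh: "linked H h h" using assms linked_verts linked_H_self by metis
  have X: "(g, h) \<in> X h" "(g', h) \<in> X h" "(g, h') \<in> X h" "(g', h') \<in> X h"
    using assms hh unfolding X_def by auto
  have "S (g, h) (g', h) = 0" using RS_eq_0(2)[OF X(1,2)] assms(4) by blast
  then have "S (mix (X h) P Q (g, h) (g, h')) (mix (X h) P Q (g', h) (g, h')) = 0"
    using s_mix_cong_left X by blast
  then show ?thesis using mixPQ[OF X(1,3)] mixPQ[OF X(2,3)] RS_eq_0(2)[OF X(3,4)] by simp
qed

text \<open>The \<open>K \<times> L\<close>-mixing operation on the copy of \<open>G\<close> over \<open>h\<close>, which it preserves by convexity.\<close>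

definition band where "band h g g' = fst (F' (fst (F (g, h)), snd (F (g', h))))"

lemma fibre_in_X: "g \<in> pverts G \<Longrightarrow> h \<in> pverts H \<Longrightarrow> (g, h) \<in> X h"
  unfolding X_def using linked_H_self by simp

lemma band_pair:
  assumes "g \<in> pverts G" "g' \<in> pverts G" "h \<in> pverts H"
  shows "(band h g g', h) = F' (fst (F (g, h)), snd (F (g', h)))"
  using mixRS_snd[OF fibre_in_X fibre_in_X, of g h g'] assms
  unfolding band_def by (simp add: prod_eq_iff)

lemma band_in:
  assumes "g \<in> pverts G" "g' \<in> pverts G" "h \<in> pverts H" shows "band h g g' \<in> pverts G"
  using mix_in_X(2)[OF fibre_in_X fibre_in_X, of g h g'] X_sub assms
  unfolding band_def by fastforce

lemma F_band:
  assumes "g \<in> pverts G" "g' \<in> pverts G" "h \<in> pverts H"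
  shows "F (band h g g', h) = (fst (F (g, h)), snd (F (g', h)))"
  using mix_in_X(3)[OF fibre_in_X fibre_in_X, of g h g'] assms by (simp add: band_pair)

text \<open>\<open>Q\<close> vanishes on the copy of \<open>G\<close> over \<open>h\<close>, so the
  two distances add up to \<open>chain_dist G\<close> whatever \<open>h\<close> is. Different copies
  thus give splittings of one and the same metric on \<open>V(G)\<close>.\<close>

lemma fibre_splitting:
  assumes h: "h \<in> pverts H"
  shows "l1_splitting (pverts G) (\<lambda>g g'. R (g, h) (g', h)) (\<lambda>g g'. S (g, h) (g', h))"
    and "g \<in> pverts G \<Longrightarrow> g' \<in> pverts G \<Longrightarrow>
      R (g, h) (g', h) + S (g, h) (g', h) = chain_dist G g g'"
    and "g \<in> pverts G \<Longrightarrow> g' \<in> pverts G \<Longrightarrow>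
      mix (pverts G) (\<lambda>g g'. R (g, h) (g', h)) (\<lambda>g g'. S (g, h) (g', h)) g g' = band h g g'"
proof -
  interpret two_l1_splittings "X h" P Q R S by (rule splittings)
  let ?r = "\<lambda>g g'. R (g, h) (g', h)" and ?s = "\<lambda>g g'. S (g, h) (g', h)"
  have X: "(g, h) \<in> X h" if "g \<in> pverts G" for g using fibre_in_X that h by blast
  have rs: "?r g (band h g g') = 0" "?s (band h g g') g' = 0" if "g \<in> pverts G" "g' \<in> pverts G" for g g'
    using RS_eq_0(1)[OF X X, of g "band h g g'"] RS_eq_0(2)[OF X X, of "band h g g'" g'] that
      band_in[OF that h] F_band[OF that h] by simp_all
  have 1: "pseudometric_on (pverts G) ?r" "pseudometric_on (pverts G) ?s"
    using T.pseudo X unfolding pseudometric_on_def by blast+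
  have 2: "g = g'" if "g \<in> pverts G" "g' \<in> pverts G" "?r g g' + ?s g g' = 0" for g g'
    using eq_if_total_0[OF X X, of g g'] same[OF X X, of g g'] that by simp
  have 3: "\<exists>z\<in>pverts G. ?r g z = 0 \<and> ?s z g' = 0" if "g \<in> pverts G" "g' \<in> pverts G" for g g'
    using rs[OF that] band_in[OF that h] by blast
  have "l1_split (pverts G) ?r ?s"
    unfolding l1_split_def by (intro conjI ballI impI 1) (fact 2 3)+
  then show split: "l1_splitting (pverts G) ?r ?s" by unfold_locales
  show "mix (pverts G) ?r ?s g g' = band h g g'" if "g \<in> pverts G" "g' \<in> pverts G"
    using l1_splitting.mix_eqI[OF split that] rs[OF that] band_in[OF that h] by blast
  show "?r g g' + ?s g g' = chain_dist G g g'" if "g \<in> pverts G" "g' \<in> pverts G"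
    using same[OF X X, of g g'] PQ_eq_0(2)[OF X X, of g g'] that unfolding P_def by simp
qed

text \<open>An arc of \<open>K \<times>\<^sub>g L\<close> is an arc in each coordinate, so the
  \<open>K\<close>-part of one arc and the \<open>L\<close>-part of another combine to an
  arc.\<close>

lemma band_arc_compatible:
  assumes "(h, h') \<in> parcs H" shows "arc_compatible G (band h) (band h')"
  unfolding arc_compatible_def
proof (intro allI impI)
  fix x x' y y' assume xy: "(x, x') \<in> parcs G" "(y, y') \<in> parcs G"
  note V = is_graphD(2,3)[OF graphs(1) xy(1)] is_graphD(2,3)[OF graphs(1) xy(2)]
    is_graphD(2,3)[OF graphs(2) assms]
  have "(F (x, h), F (x', h')) \<in> parcs (K \<times>\<^sub>g L)" "(F (y, h), F (y', h')) \<in> parcs (K \<times>\<^sub>g L)"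
    using F_arc V xy assms by simp_all
  then have "(F (band h x y, h), F (band h' x' y', h')) \<in> parcs (K \<times>\<^sub>g L)"
    using F_band V by (simp add: direct_prod_arc_iff)
  then show "(band h x y, band h' x' y') \<in> parcs G" using F_arc band_in V by simp
qed

text \<open>Both bands come from splittings of the metric of \<open>G\<close>, so strict refinement
  applies even when \<open>h\<close> and \<open>h'\<close> are not linked, as at the ends of an edge
  of a bipartite \<open>H\<close>.\<close>

lemma commuting_fibre_bands:
  assumes h: "h \<in> pverts H" "h' \<in> pverts H"
  shows "commuting_bands (pverts G) (band h) (band h')"
proof -
  let ?V = "pverts G" and ?r = "\<lambda>h g g'. R (g, h) (g', h)" and ?s = "\<lambda>h g g'. S (g, h) (g', h)"
  interpret two_l1_splittings ?V "?r h" "?s h" "?r h'" "?s h'"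
    using fibre_splitting(1,2)[OF h(1)] fibre_splitting(1,2)[OF h(2)]
    by (simp add: two_l1_splittings_def two_l1_splittings_axioms_def)
  have m: "g \<in> ?V \<Longrightarrow> g' \<in> ?V \<Longrightarrow> S.m g g' = band h g g'"
    "g \<in> ?V \<Longrightarrow> g' \<in> ?V \<Longrightarrow> T.m g g' = band h' g g'" for g g'
    using fibre_splitting(3) h by blast+
  have "rectangular_band ?V (band h)" "rectangular_band ?V (band h')"
    using rectangular_band_cong[OF S.rectangular_band_axioms m(1)]
      rectangular_band_cong[OF T.rectangular_band_axioms m(2)] by blast+
  moreover have "band h (band h' x y) (band h' z w) = band h' (band h x z) (band h y w)"
    if "x \<in> ?V" "y \<in> ?V" "z \<in> ?V" "w \<in> ?V" for x y z w
    using mix_commute[OF that(1,3,2,4)] m that band_in h by simp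
  ultimately show ?thesis
    by (simp add: commuting_bands_def commuting_bands_axioms_def)
qed

text \<open>If both bands are first projections, \<open>F_band\<close> makes the
  \<open>L\<close>-coordinate of \<open>F\<close> constant on the copies of \<open>G\<close> over
  \<open>h0\<close> and \<open>h1\<close>; second projections do the same for the
  \<open>K\<close>-coordinate. Every vertex of \<open>H\<close> is linked to \<open>h0\<close> or
  \<open>h1\<close>, so this spreads to all copies.\<close>

lemma dichotomy:
  "(\<forall>g\<in>pverts G. \<forall>g'\<in>pverts G. \<forall>h\<in>pverts H. snd (F (g, h)) = snd (F (g', h))) \<or>
   (\<forall>g\<in>pverts G. \<forall>g'\<in>pverts G. \<forall>h\<in>pverts H. fst (F (g, h)) = fst (F (g', h)))"
proof -
  note h = is_graphD(2,3)[OF graphs(2) edge]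
  have "pverts G \<noteq> {}" using prime unfolding prime_graph_def by auto
  then obtain g where "linked G g g" using linked_G by blast
  then have "parcs G \<noteq> {}" unfolding linked_def using chain_verts[of G g g]
    by (auto simp: in_neighbourhood_iff[OF graphs(1)] neighbourhood_def)
  from prime_loopless_bands_trivial[OF prime loopless this commuting_fibre_bands[OF h]
      band_arc_compatible[OF edge]]
  show ?thesis
  proof
    assume *: "\<forall>x\<in>pverts G. \<forall>y\<in>pverts G. band h0 x y = x \<and> band h1 x y = x"
    have "snd (F (g, h)) = snd (F (g', h))"
      if g: "g \<in> pverts G" "g' \<in> pverts G" and "h \<in> pverts H" for g g' h
    proof -
      have "snd (F (g, h0)) = snd (F (g', h0))" "snd (F (g, h1)) = snd (F (g', h1))"
        using arg_cong[OF F_band[OF g h(1)], of snd] arg_cong[OF F_band[OF g h(2)], of snd] * g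
        by simp_all
      then show ?thesis using linked_H[OF \<open>h \<in> pverts H\<close>] F_snd_indep[OF g] by blast
    qed
    then show ?thesis by blast
  next
    assume *: "\<forall>x\<in>pverts G. \<forall>y\<in>pverts G. band h0 x y = y \<and> band h1 x y = y"
    have "fst (F (g, h)) = fst (F (g', h))"
      if g: "g \<in> pverts G" "g' \<in> pverts G" and "h \<in> pverts H" for g g' h
    proof -
      have "fst (F (g, h0)) = fst (F (g', h0))" "fst (F (g, h1)) = fst (F (g', h1))"
        using arg_cong[OF F_band[OF g h(1)], of fst] arg_cong[OF F_band[OF g h(2)], of fst] * g
        by simp_all
      then show ?thesis using linked_H[OF \<open>h \<in> pverts H\<close>] F_fst_indep[OF g] by blast
    qed
    then show ?thesis by blast
  qed
qed

text \<open>The vertices that \<open>F\<close> sends to \<open>K\<close>-coordinate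
  \<open>k0\<close> form a product of \<open>V(G)\<close> with a set of
  \<open>H\<close>-coordinates, and \<open>F\<close> identifies it with \<open>V(L)\<close>.
  Convexity shows that adjacency splits accordingly.\<close>

lemma factor_of_second:
  assumes indep: "\<And>g g' h. g \<in> pverts G \<Longrightarrow> g' \<in> pverts G \<Longrightarrow> h \<in> pverts H \<Longrightarrow>
    fst (F (g, h)) = fst (F (g', h))"
  shows "\<exists>f (L' :: 'h graph). is_graph L' \<and> graph_iso f L (L' \<times>\<^sub>g G)"
proof -
  \<comment> \<open>\<open>L'\<close> lives on the \<open>H\<close>-coordinates of the fibre of \<open>L\<close> over \<open>k0\<close>, which is \<open>V(G) \<times> V(L')\<close> by \<open>indep\<close>.\<close>
  obtain c where c: "c \<in> pverts G" using prime unfolding prime_graph_def by fastforce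
  have "(c, h0) \<in> pverts G \<times> pverts H" using c is_graphD(2)[OF graphs(2) edge] by blast
  from F_in[OF this] obtain k0 where k0: "k0 \<in> pverts K" by auto
  \<comment> \<open>\<open>k0\<close> need not carry a loop, so arcs of \<open>L\<close> are lifted
    to arcs from the copy over \<open>k0\<close> to the copy over a neighbour
    \<open>k1\<close>.\<close>
  from linked_K[OF k0 k0] obtain k1 where k01: "(k0, k1) \<in> parcs K"
    unfolding linked_def using chain_verts[of K k0 k0] in_neighbourhood_iff[OF graphs(3)] by blast
  have k1: "k1 \<in> pverts K" using is_graphD(3)[OF graphs(3) k01] .
  define \<gamma> where "\<gamma> k l = fst (F' (k, l))" for k l
  define \<eta> where "\<eta> k l = snd (F' (k, l))" for k l
  have F': "F' (k, l) = (\<gamma> k l, \<eta> k l)" for k l unfolding \<gamma>_def \<eta>_def by simp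
  have in_GH: "\<gamma> k l \<in> pverts G" "\<eta> k l \<in> pverts H" "F (\<gamma> k l, \<eta> k l) = (k, l)"
    if "k \<in> pverts K" "l \<in> pverts L" for k l
    using F'_in[of "(k, l)"] F_F'[of "(k, l)"] that unfolding F' by auto
  have X: "F' (k', l) \<in> X (\<eta> k l)" if "k \<in> pverts K" "k' \<in> pverts K" "l \<in> pverts L" for k k' l
  proof -
    have x: "F' (k, l) \<in> X (\<eta> k l)" unfolding F' using in_GH that by (intro fibre_in_X) auto
    have "linked (K \<times>\<^sub>g L) (k, l) (k', l)"
      using X_linked(5)[OF x x] linked_K that in_GH(3) F'
      by (simp add: linked_direct_prod_iff[OF graphs(3,4)])
    then have "linked (G \<times>\<^sub>g H) (F' (k, l)) (F' (k', l))"
      using F_linked[of "F' (k, l)" "F' (k', l)"] F'_in F_F' that by simp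
    then show ?thesis using X_I x by blast
  qed
  \<comment> \<open>\<open>y\<close> shares its \<open>G\<close>-coordinate with
    \<open>F' (k, l)\<close> and has \<open>K\<close>-coordinate \<open>k'\<close> by
    \<open>indep\<close>. Mixing the two gives \<open>F' (k', l)\<close>, and convexity preserves
    the common \<open>G\<close>-coordinate.\<close>
  have \<gamma>_const: "\<gamma> k' l = \<gamma> k l" if k: "k \<in> pverts K" "k' \<in> pverts K" and l: "l \<in> pverts L" for k k' l
  proof -
    let ?x = "F' (k, l)" and ?x' = "F' (k', l)"
    define y where "y = (\<gamma> k l, \<eta> k' l)"
    note x = X[OF k(1,1) l] and x' = X[OF k l]
    have y: "y \<in> X (\<eta> k l)" using mix_in_X(1)[OF x x'] unfolding y_def F' by simp
    have "fst (F y) = k'" unfolding y_def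
      using indep[OF in_GH(1)[OF k(1) l] in_GH(1)[OF k(2) l] in_GH(2)[OF k(2) l]] in_GH(3)[OF k(2) l]
      by simp
    then show ?thesis
      using mixRS_fst[OF y x] in_GH(3)[OF k(1) l] unfolding F' y_def by simp
  qed
  \<comment> \<open>Mixing \<open>F' (k', l)\<close> with \<open>F' (k, l)\<close> and with
    \<open>F' (k, m)\<close> gives \<open>F' (k', l)\<close> and \<open>F' (k', m)\<close>, and
    equality of \<open>H\<close>-coordinates is a congruence for mixing.\<close>
  have \<eta>_cong: "\<eta> k' l = \<eta> k' m" if k: "k \<in> pverts K" "k' \<in> pverts K"
    and l: "l \<in> pverts L" "m \<in> pverts L" and eq: "\<eta> k l = \<eta> k m" for k k' l m
  proof -
    have m: "F' (k, m) \<in> X (\<eta> k l)" using X[OF k(1,1) l(2)] eq by simp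
    have "F (F' (k', l)) = (k', l)" "F (F' (k, l)) = (k, l)" "F (F' (k, m)) = (k, m)"
      using F_F' k l by simp_all
    then show ?thesis
      using mixRS_snd_cong[OF X[OF k l(1)] X[OF k l(1)] X[OF k(1,1) l(1)] m] eq
      unfolding \<eta>_def by simp
  qed
  define L' where "L' = \<lparr>pverts = {h \<in> pverts H. fst (F (c, h)) = k0},
    parcs = (\<lambda>(l, m). (\<eta> k0 l, \<eta> k0 m)) ` parcs L\<rparr>"
  have verts: "pverts L' = {h \<in> pverts H. fst (F (c, h)) = k0}" unfolding L'_def by simp
  have arcs: "(h, h') \<in> parcs L' \<longleftrightarrow> (\<exists>l m. (l, m) \<in> parcs L \<and> h = \<eta> k0 l \<and> h' = \<eta> k0 m)" for h h'
    unfolding L'_def by force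
  have \<eta>_in: "\<eta> k0 l \<in> pverts L'" if "l \<in> pverts L" for l
    unfolding verts using indep[OF c in_GH(1,2)[OF k0 that]] in_GH[OF k0 that] by simp
  have L': "is_graph L'"
    unfolding is_graph_iff
  proof (intro conjI)
    show "finite (pverts L')" unfolding verts using is_graphD(1)[OF graphs(2)] by simp
    show "parcs L' \<subseteq> pverts L' \<times> pverts L'" using \<eta>_in is_graphD(2,3)[OF graphs(4)] by (auto simp: arcs)
    show "sym (parcs L')" unfolding sym_def arcs using is_graphD(4)[OF graphs(4)] by blast
  qed
  define f where "f l = (\<eta> k0 l, \<gamma> k0 l)" for l
  have "bij_betw f (pverts L) (pverts (L' \<times>\<^sub>g G))"
  proof (rule bij_betw_byWitness[where f' = "\<lambda>(h, g). snd (F (g, h))"])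
    show "\<forall>l\<in>pverts L. (case f l of (h, g) \<Rightarrow> snd (F (g, h))) = l"
      unfolding f_def using in_GH(3)[OF k0] by simp
    show "\<forall>p\<in>pverts (L' \<times>\<^sub>g G). f (case p of (h, g) \<Rightarrow> snd (F (g, h))) = p"
    proof
      fix p assume "p \<in> pverts (L' \<times>\<^sub>g G)"
      then obtain h g where p: "p = (h, g)" "h \<in> pverts L'" "g \<in> pverts G" by auto
      then have "F (g, h) = (k0, snd (F (g, h)))"
        using indep[OF p(3) c] unfolding verts by (simp add: prod_eq_iff)
      then have "F' (k0, snd (F (g, h))) = (g, h)" using F'_F[of "(g, h)"] p unfolding verts by simp
      then show "f (case p of (h, g) \<Rightarrow> snd (F (g, h))) = p" unfolding f_def p(1) \<gamma>_def \<eta>_def by simp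
    qed
    show "f ` pverts L \<subseteq> pverts (L' \<times>\<^sub>g G)" unfolding f_def using \<eta>_in in_GH(1)[OF k0] by auto
    show "(\<lambda>(h, g). snd (F (g, h))) ` pverts (L' \<times>\<^sub>g G) \<subseteq> pverts L"
      using F_in unfolding verts by (fastforce simp: verts mem_Times_iff)
  qed
  moreover have "(l, m) \<in> parcs L \<longleftrightarrow> (f l, f m) \<in> parcs (L' \<times>\<^sub>g G)"
    if l: "l \<in> pverts L" and m: "m \<in> pverts L" for l m
  proof -
    have arc_L: "(a, b) \<in> parcs L \<longleftrightarrow> (\<gamma> k0 a, \<gamma> k0 b) \<in> parcs G \<and> (\<eta> k0 a, \<eta> k1 b) \<in> parcs H"
      if ab: "a \<in> pverts L" "b \<in> pverts L" for a b
    proof -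
      have "(a, b) \<in> parcs L \<longleftrightarrow> (F (F' (k0, a)), F (F' (k1, b))) \<in> parcs (K \<times>\<^sub>g L)"
        using k01 F_F' k0 k1 ab by simp
      also have "\<dots> \<longleftrightarrow> (F' (k0, a), F' (k1, b)) \<in> parcs (G \<times>\<^sub>g H)"
        using F_arc F'_in k0 k1 ab by simp
      finally show ?thesis unfolding F' using \<gamma>_const[OF k0 k1 ab(2)] by simp
    qed
    show ?thesis
    proof
      assume "(l, m) \<in> parcs L"
      then show "(f l, f m) \<in> parcs (L' \<times>\<^sub>g G)" unfolding f_def using arc_L[OF l m] by (auto simp: arcs)
    next
      assume "(f l, f m) \<in> parcs (L' \<times>\<^sub>g G)"
      \<comment> \<open>\<open>m\<close> and \<open>b\<close> share their
        \<open>H\<close>-coordinate over \<open>k0\<close>, hence also over \<open>k1\<close>, so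
        the \<open>H\<close>-part of the arc \<open>(a, b)\<close> serves for
        \<open>(l, m)\<close>.\<close>
      then obtain a b where ab: "(a, b) \<in> parcs L" "\<eta> k0 l = \<eta> k0 a" "\<eta> k0 m = \<eta> k0 b"
        and g: "(\<gamma> k0 l, \<gamma> k0 m) \<in> parcs G" unfolding f_def by (auto simp: arcs)
      have V: "a \<in> pverts L" "b \<in> pverts L" using is_graphD(2,3)[OF graphs(4) ab(1)] by blast+
      have "(\<eta> k0 a, \<eta> k1 b) \<in> parcs H" using arc_L[OF V] ab(1) by blast
      then show "(l, m) \<in> parcs L" using arc_L[OF l m] g ab \<eta>_cong[OF k0 k1 m V(2) ab(3)] by simp
    qed
  qed
  ultimately show ?thesis using L' unfolding graph_iso_def by blast
qed

end

section \<open>Splitting off a prime factor\<close>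

lemma direct_prod_list_simps:
  "xs \<in> pverts (direct_prod_list Gs) \<longleftrightarrow>
     length xs = length Gs \<and> (\<forall>i<length Gs. xs ! i \<in> pverts (Gs ! i))"
  "(xs, ys) \<in> parcs (direct_prod_list Gs) \<longleftrightarrow> length xs = length Gs \<and> length ys = length Gs \<and>
     (\<forall>i<length Gs. (xs ! i, ys ! i) \<in> parcs (Gs ! i))"
  by (simp_all add: direct_prod_list_def)

lemma is_graph_direct_prod_list:
  assumes "\<And>F. F \<in> set Gs \<Longrightarrow> is_graph F"
  shows "is_graph (direct_prod_list Gs)"
  unfolding is_graph_iff
proof (intro conjI)
  have *: "is_graph (Gs ! i)" if "i < length Gs" for i using assms that by simp
  let ?A = "\<Union>F\<in>set Gs. pverts F"
  have "finite ?A" using assms is_graphD(1) by blast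
  then have "finite {xs. set xs \<subseteq> ?A \<and> length xs = length Gs}" by (rule finite_lists_length_eq)
  moreover have "pverts (direct_prod_list Gs) \<subseteq> {xs. set xs \<subseteq> ?A \<and> length xs = length Gs}"
    by (auto simp: direct_prod_list_simps in_set_conv_nth) (metis nth_mem)
  ultimately show "finite (pverts (direct_prod_list Gs))" by (rule finite_subset[rotated])
  show "parcs (direct_prod_list Gs) \<subseteq> pverts (direct_prod_list Gs) \<times> pverts (direct_prod_list Gs)"
    using is_graphD(2,3)[OF *] by (auto simp: direct_prod_list_simps) blast+
  show "sym (parcs (direct_prod_list Gs))"
    using is_graphD(4)[OF *] by (auto simp: direct_prod_list_simps sym_def)
qed

text \<open>
  The complement of the \<open>i\<close>-th factor is the product with that factor replaced by the unit, rather
  than deleted, so that the positions of the other factors do not shift.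
\<close>

definition unit_graph :: "nat graph" where
  "unit_graph = \<lparr>pverts = {0}, parcs = {(0, 0)}\<rparr>"

lemma unit_graph_simps: "pverts unit_graph = {0}" "parcs unit_graph = {(0, 0)}"
  by (simp_all add: unit_graph_def)

lemma is_graph_unit_graph: "is_graph unit_graph"
  unfolding is_graph_iff sym_def by (simp add: unit_graph_simps)

lemma graph_iso_split_factor:
  assumes "i < length Gs"
  shows "graph_iso (\<lambda>(g, r). r[i := g]) (Gs ! i \<times>\<^sub>g direct_prod_list (Gs[i := unit_graph]))
    (direct_prod_list Gs)"
proof -
  let ?R = "direct_prod_list (Gs[i := unit_graph])"
  have zero: "r ! i = 0" if "r \<in> pverts ?R" for r
    using that assms by (auto simp: direct_prod_list_simps unit_graph_simps)
  have "bij_betw (\<lambda>(g, r). r[i := g]) (pverts (Gs ! i \<times>\<^sub>g ?R)) (pverts (direct_prod_list Gs))"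
  proof (rule bij_betw_byWitness[where f' = "\<lambda>xs. (xs ! i, xs[i := 0])"])
    show "\<forall>p\<in>pverts (Gs ! i \<times>\<^sub>g ?R). (\<lambda>xs. (xs ! i, xs[i := 0])) (case p of (g, r) \<Rightarrow> r[i := g]) = p"
    proof
      fix p assume "p \<in> pverts (Gs ! i \<times>\<^sub>g ?R)"
      then obtain g r where p: "p = (g, r)" "g \<in> pverts (Gs ! i)" "r \<in> pverts ?R" by auto
      have "length r = length Gs" using p(3) by (simp add: direct_prod_list_simps)
      moreover have "r[i := 0] = r" using zero[OF p(3)] list_update_id[of r i] by simp
      ultimately show "(\<lambda>xs. (xs ! i, xs[i := 0])) (case p of (g, r) \<Rightarrow> r[i := g]) = p"
        using assms p(1) by simp
    qed
    show "\<forall>xs\<in>pverts (direct_prod_list Gs). (case (xs ! i, xs[i := 0]) of (g, r) \<Rightarrow> r[i := g]) = xs"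
      by simp
    show "(\<lambda>(g, r). r[i := g]) ` pverts (Gs ! i \<times>\<^sub>g ?R) \<subseteq> pverts (direct_prod_list Gs)"
      using assms by (auto simp: direct_prod_list_simps nth_list_update) metis
    show "(\<lambda>xs. (xs ! i, xs[i := 0])) ` pverts (direct_prod_list Gs) \<subseteq> pverts (Gs ! i \<times>\<^sub>g ?R)"
      using assms by (auto simp: direct_prod_list_simps nth_list_update unit_graph_simps)
  qed
  moreover have "((g, r), (g', r')) \<in> parcs (Gs ! i \<times>\<^sub>g ?R) \<longleftrightarrow>
      (r[i := g], r'[i := g']) \<in> parcs (direct_prod_list Gs)"
    if "r \<in> pverts ?R" "r' \<in> pverts ?R" for g g' r r'
  proof -
    have "length r = length Gs" "length r' = length Gs"
      using that by (simp_all add: direct_prod_list_simps)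
    then show ?thesis using zero[OF that(1)] zero[OF that(2)] assms
      by (auto simp: direct_prod_list_simps nth_list_update unit_graph_simps)
  qed
  ultimately show ?thesis unfolding graph_iso_def by auto
qed

lemma graph_iso_assoc: "graph_iso (\<lambda>(a, b, c). ((a, b), c)) (A \<times>\<^sub>g B \<times>\<^sub>g C) ((A \<times>\<^sub>g B) \<times>\<^sub>g C)"
  unfolding graph_iso_def by (auto simp: bij_betw_def inj_on_def image_iff)

lemma graph_iso_id: "graph_iso id G G"
  unfolding graph_iso_def by simp

text \<open>Frees the cofactors from the type \<open>nat\<close> by copying them there;
  \<open>D\<close> will be a prime factor, which lives on \<open>nat\<close> already.\<close>

lemma coprime_graphsD:
  fixes D :: "nat graph"
  assumes "coprime_graphs G H" "is_graph G" "is_graph H" "is_graph A" "is_graph B" "is_graph D"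
    and "graph_iso f G (A \<times>\<^sub>g D)" "graph_iso g H (B \<times>\<^sub>g D)"
  shows "card (pverts D) \<le> 1"
proof (rule ccontr)
  assume D: "\<not> card (pverts D) \<le> 1"
  obtain a A' where A': "is_graph (A' :: nat graph)" "graph_iso a A A'"
    using ex_nat_graph_iso[OF assms(4)] by blast
  obtain b B' where B': "is_graph (B' :: nat graph)" "graph_iso b B B'"
    using ex_nat_graph_iso[OF assms(5)] by blast
  have "G \<simeq>\<^sub>g A' \<times>\<^sub>g D"
    using graph_iso_comp[OF assms(7) graph_iso_direct_prod[OF A'(2) graph_iso_id]]
      isomorphic_iff_graph_iso[OF assms(2) is_graph_direct_prod[OF A'(1) assms(6)]] by blast
  moreover have "H \<simeq>\<^sub>g B' \<times>\<^sub>g D"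
    using graph_iso_comp[OF assms(8) graph_iso_direct_prod[OF B'(2) graph_iso_id]]
      isomorphic_iff_graph_iso[OF assms(3) is_graph_direct_prod[OF B'(1) assms(6)]] by blast
  ultimately show False
    using assms(1,6) A'(1) B'(1) D unfolding coprime_graphs_def by auto
qed

text \<open>Instance of \<open>factor_iso\<close> for the \<open>i\<close>-th factor. The second
  alternative of \<open>dichotomy\<close> would make it a common factor of \<Gamma> and \<Sigma>,
  which coprimality excludes since a prime graph has more than one vertex.\<close>

lemma snd_indep_of_coordinate:
  fixes \<Gamma> :: "'a graph" and \<Sigma> :: "'b graph"
  assumes graphs: "is_graph \<Gamma>" "is_graph \<Sigma>" and coprime: "coprime_graphs \<Gamma> \<Sigma>"
    and twin_free: "twin_free \<Gamma>" "twin_free \<Sigma>"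
    and linked: "\<And>x y. x \<in> pverts \<Gamma> \<Longrightarrow> y \<in> pverts \<Gamma> \<Longrightarrow> linked \<Gamma> x y"
    and edge: "(s0, s1) \<in> parcs \<Sigma>" "\<And>s. s \<in> pverts \<Sigma> \<Longrightarrow> linked \<Sigma> s0 s \<or> linked \<Sigma> s1 s"
    and factors: "\<And>F :: nat graph. F \<in> set Gs \<Longrightarrow> prime_graph F" "\<And>F. F \<in> set Gs \<Longrightarrow> loopless F"
    and \<psi>: "graph_iso \<psi> (direct_prod_list Gs) \<Gamma>"
    and f: "graph_iso f (\<Gamma> \<times>\<^sub>g \<Sigma>) (\<Gamma> \<times>\<^sub>g \<Sigma>)"
    and i: "i < length Gs" and xs: "xs \<in> pverts (direct_prod_list Gs)"
    and y: "y \<in> pverts (Gs ! i)" and s: "s \<in> pverts \<Sigma>"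
  shows "snd (f (\<psi> (xs[i := y]), s)) = snd (f (\<psi> xs, s))"
proof -
  define G where "G = Gs ! i"
  define R where "R = direct_prod_list (Gs[i := unit_graph])"
  have G: "prime_graph G" "loopless G" "is_graph G" "card (pverts G) > 1"
    using factors[of G] i unfolding G_def prime_graph_def by auto
  have R: "is_graph R"
    unfolding R_def using factors(1) is_graph_unit_graph set_update_subset_insert[of Gs i unit_graph]
    by (intro is_graph_direct_prod_list) (auto simp: prime_graph_def)
  define \<chi> where "\<chi> = \<psi> \<circ> (\<lambda>(g, r). r[i := g])"
  have \<chi>: "graph_iso \<chi> (G \<times>\<^sub>g R) \<Gamma>"
    unfolding \<chi>_def G_def R_def using graph_iso_comp[OF graph_iso_split_factor[OF i] \<psi>] .
  have xs_R: "xs[i := 0] \<in> pverts R" and xs_i: "xs ! i \<in> pverts G"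
    using xs i unfolding R_def G_def
    by (auto simp: direct_prod_list_simps nth_list_update unit_graph_simps)
  define F where "F = f \<circ> (map_prod \<chi> id \<circ> (\<lambda>(a, b, c). ((a, b), c)))"
  have F: "graph_iso F (G \<times>\<^sub>g R \<times>\<^sub>g \<Sigma>) (\<Gamma> \<times>\<^sub>g \<Sigma>)"
    unfolding F_def
    by (rule graph_iso_comp[OF graph_iso_comp[OF graph_iso_assoc
          graph_iso_direct_prod[OF \<chi> graph_iso_id]] f])
  have linked_GR: "linked G g g' \<and> linked R r r'"
    if "g \<in> pverts G" "g' \<in> pverts G" "r \<in> pverts R" "r' \<in> pverts R" for g g' r r'
  proof -
    have "\<chi> (g, r) \<in> pverts \<Gamma>" "\<chi> (g', r') \<in> pverts \<Gamma>"
      using \<chi> that bij_betwE[of \<chi> "pverts (G \<times>\<^sub>g R)" "pverts \<Gamma>"] unfolding graph_iso_def by auto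
    then have "linked (G \<times>\<^sub>g R) (g, r) (g', r')"
      using linked linked_iso[OF is_graph_direct_prod[OF G(3) R] graphs(1) \<chi>, of "(g, r)" "(g', r')"]
        that by simp
    then show ?thesis using linked_direct_prod_iff[OF G(3) R] by simp
  qed
  obtain r0 where r0: "r0 \<in> pverts R" using xs_R by blast
  have "linked R r0 r0" using linked_GR[OF xs_i xs_i r0 r0] by blast
  \<comment> \<open>A vertex linked to itself has a neighbour, so the edge of \<Sigma> lifts to an
    edge of \<open>R \<times>\<^sub>g \<Sigma>\<close>.\<close>
  then obtain r1 where r01: "(r0, r1) \<in> parcs R"
    unfolding linked_def using chain_verts[of R r0 r0] in_neighbourhood_iff[OF R] by blast
  have r1: "r1 \<in> pverts R" using is_graphD(3)[OF R r01] .
  interpret I: factor_iso G "R \<times>\<^sub>g \<Sigma>" \<Gamma> \<Sigma> F "(r0, s0)" "(r1, s1)"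
  proof (rule factor_iso.intro)
    show "linked G g g'" if "g \<in> pverts G" "g' \<in> pverts G" for g g'
      using linked_GR[OF that r0 r0] by blast
    show "linked (R \<times>\<^sub>g \<Sigma>) (r0, s0) h \<or> linked (R \<times>\<^sub>g \<Sigma>) (r1, s1) h"
      if "h \<in> pverts (R \<times>\<^sub>g \<Sigma>)" for h
      using that edge(2)[of "snd h"] linked_GR[OF xs_i xs_i r0, of "fst h"]
        linked_GR[OF xs_i xs_i r1, of "fst h"]
      by (auto simp: linked_direct_prod_iff[OF R graphs(2)])
  qed (use G R graphs twin_free F linked edge r01 is_graph_direct_prod in auto)
  have "\<not> (\<forall>g\<in>pverts G. \<forall>g'\<in>pverts G. \<forall>h\<in>pverts (R \<times>\<^sub>g \<Sigma>). fst (F (g, h)) = fst (F (g', h)))"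
  proof
    assume "\<forall>g\<in>pverts G. \<forall>g'\<in>pverts G. \<forall>h\<in>pverts (R \<times>\<^sub>g \<Sigma>). fst (F (g, h)) = fst (F (g', h))"
    then obtain e and L' :: "(nat list \<times> 'b) graph"
      where "is_graph L'" "graph_iso e \<Sigma> (L' \<times>\<^sub>g G)" using I.factor_of_second by blast
    from coprime_graphsD[OF coprime graphs R this(1) G(3)
        graph_iso_comp[OF graph_iso_inv[OF \<chi>] graph_iso_swap] this(2)]
    show False using G(4) by simp
  qed
  then have "snd (F (y, xs[i := 0], s)) = snd (F (xs ! i, xs[i := 0], s))"
    using I.dichotomy y xs_i xs_R s unfolding G_def[symmetric] by auto
  then show ?thesis unfolding F_def \<chi>_def by simp
qed

section \<open>Preservation of the \<Sigma>-partition\<close>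

theorem mainTheorem6:
  shows "\<not> (\<exists>(\<Gamma> :: 'a graph) (\<Sigma> :: 'b graph).
    nontrivially_unstable \<Gamma> \<Sigma> \<and> \<not> bipartite \<Gamma> \<and> bipartite \<Sigma> \<and>
    (\<exists>f. mixer \<Gamma> \<Sigma> f) \<and> factor_loopless \<Gamma>)"
proof (rule notI, elim exE conjE)
  fix \<Gamma> :: "'a graph" and \<Sigma> :: "'b graph" and f
  assume unstable: "nontrivially_unstable \<Gamma> \<Sigma>" and bip: "\<not> bipartite \<Gamma>" "bipartite \<Sigma>"
    and mixer: "mixer \<Gamma> \<Sigma> f" and "factor_loopless \<Gamma>"
  have graphs: "is_graph \<Gamma>" "is_graph \<Sigma>" and coprime: "coprime_graphs \<Gamma> \<Sigma>"
    and conn: "connected_graph \<Gamma>" "connected_graph \<Sigma>"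
    and twin_free: "twin_free \<Gamma>" "twin_free \<Sigma>"
    and sides: "\<exists>A B. bipartition \<Sigma> A B \<and> A \<noteq> {} \<and> B \<noteq> {}"
    using unstable bip unfolding nontrivially_unstable_def nontrivial_pair_def by simp_all
  obtain Gs where Gs: "prime_factorization_of \<Gamma> Gs" "\<And>F. F \<in> set Gs \<Longrightarrow> loopless F"
    using \<open>factor_loopless \<Gamma>\<close> unfolding factor_loopless_def by blast
  have prime: "\<And>F. F \<in> set Gs \<Longrightarrow> prime_graph F" using Gs(1) unfolding prime_factorization_of_def by blast
  then have "is_graph (direct_prod_list Gs)"
    by (intro is_graph_direct_prod_list) (simp add: prime_graph_def)
  then obtain \<phi> where "graph_iso \<phi> \<Gamma> (direct_prod_list Gs)"
    using Gs(1) isomorphic_iff_graph_iso[OF graphs(1)] unfolding prime_factorization_of_def by blast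
  then obtain \<psi> where \<psi>: "graph_iso \<psi> (direct_prod_list Gs) \<Gamma>" using graph_iso_inv by blast
  have linked: "linked \<Gamma> x y" if "x \<in> pverts \<Gamma>" "y \<in> pverts \<Gamma>" for x y
    using connected_nonbipartite_linked[OF graphs(1) conn(1) bip(1)] that by blast
  obtain s0 s1 where edge: "(s0, s1) \<in> parcs \<Sigma>"
  proof -
    obtain a b where ab: "a \<in> pverts \<Sigma>" "b \<in> pverts \<Sigma>" "a \<noteq> b"
      using sides unfolding bipartition_def by blast
    \<comment> \<open>Without edges a single vertex is closed under adjacency, so connectedness
      would leave only one vertex, whereas \<Sigma> has one on each side.\<close>
    have "parcs \<Sigma> \<noteq> {}"
    proof
      assume "parcs \<Sigma> = {}"
      then have "{a} = pverts \<Sigma>" using ab by (intro connected_graph_induct[OF conn(2)]) auto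
      then have "b \<in> {a}" using ab by simp
      then show False using ab by simp
    qed
    then show ?thesis using that by auto
  qed
  have f_bij: "bij_betw f (pverts \<Gamma> \<times> pverts \<Sigma>) (pverts \<Gamma> \<times> pverts \<Sigma>)"
    and f: "graph_iso f (\<Gamma> \<times>\<^sub>g \<Sigma>) (\<Gamma> \<times>\<^sub>g \<Sigma>)"
    using mixer unfolding mixer_def Aut_def graph_iso_def by auto
  have change: "snd (f (\<psi> (xs[i := y]), s)) = snd (f (\<psi> xs, s))"
    if "i < length Gs" "xs \<in> pverts (direct_prod_list Gs)" "y \<in> pverts (Gs ! i)" "s \<in> pverts \<Sigma>"
    for xs i y s
    by (rule snd_indep_of_coordinate[OF graphs coprime twin_free linked edge
          connected_linked_to_edge[OF graphs(2) conn(2) edge] prime Gs(2) \<psi> f that])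
  have step: "snd (f (\<psi> ys, s)) = snd (f (\<psi> xs, s))"
    if xs: "xs \<in> pverts (direct_prod_list Gs)" and ys: "ys \<in> pverts (direct_prod_list Gs)"
      and s: "s \<in> pverts \<Sigma>" for xs ys s
  proof -
    have len: "length xs = length Gs" "length ys = length Gs"
      using xs ys by (simp_all add: direct_prod_list_simps)
    \<comment> \<open>\<open>xs\<close> is turned into \<open>ys\<close> one coordinate at a time,
      from the left.\<close>
    have "snd (f (\<psi> (take m ys @ drop m xs), s)) = snd (f (\<psi> xs, s))" if "m \<le> length Gs" for m
      using that
    proof (induction m)
      case (Suc m)
      let ?zs = "take m ys @ drop m xs"
      have zs: "?zs \<in> pverts (direct_prod_list Gs)"
        using xs ys Suc.prems by (auto simp: direct_prod_list_simps nth_append)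
      have "take (Suc m) ys @ drop (Suc m) xs = ?zs[m := ys ! m]"
        using Suc.prems len
        by (intro nth_equalityI) (auto simp: nth_append nth_list_update less_Suc_eq)
      then show ?case
        using change[OF _ zs _ s, of m "ys ! m"] Suc ys by (simp add: direct_prod_list_simps)
    qed simp
    from this[of "length Gs"] show ?thesis using len by simp
  qed
  have surj: "\<psi> ` pverts (direct_prod_list Gs) = pverts \<Gamma>"
    using \<psi> unfolding graph_iso_def bij_betw_def by blast
  have indep: "snd (f (u, s)) = snd (f (v, s))"
    if "u \<in> pverts \<Gamma>" "v \<in> pverts \<Gamma>" "s \<in> pverts \<Sigma>" for u v s
    using that step unfolding surj[symmetric] by blast
  have "pverts \<Gamma> \<noteq> {}"
    using conn(1) unfolding connected_graph_def connected_def strongly_connected_def by simp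
  then obtain u where u: "u \<in> pverts \<Gamma>" by blast
  \<comment> \<open>By \<open>indep\<close> the choice of \<open>u\<close> does not matter:
    \<open>t\<close> is the map that \<open>f\<close> induces on V(\<Sigma>).\<close>
  define t where "t s = snd (f (u, s))" for s
  have f_in: "f p \<in> pverts \<Gamma> \<times> pverts \<Sigma>" if "p \<in> pverts \<Gamma> \<times> pverts \<Sigma>" for p
    using bij_betwE[OF f_bij] that by blast
  have t_in: "t s \<in> pverts \<Sigma>" if "s \<in> pverts \<Sigma>" for s
    using f_in[of "(u, s)"] u that unfolding t_def by auto
  have image: "f ` (pverts \<Gamma> \<times> {s}) = pverts \<Gamma> \<times> {t s}" if s: "s \<in> pverts \<Sigma>" for s
  proof (rule card_subset_eq)
    show "finite (pverts \<Gamma> \<times> {t s})" using is_graphD(1)[OF graphs(1)] by simp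
    show "f ` (pverts \<Gamma> \<times> {s}) \<subseteq> pverts \<Gamma> \<times> {t s}"
    proof
      fix p assume "p \<in> f ` (pverts \<Gamma> \<times> {s})"
      then obtain v where v: "v \<in> pverts \<Gamma>" "p = f (v, s)" by auto
      then have "snd p = t s" "fst p \<in> pverts \<Gamma>"
        using indep[OF v(1) u s] f_in[of "(v, s)"] s unfolding t_def by auto
      then show "p \<in> pverts \<Gamma> \<times> {t s}" by (simp add: mem_Times_iff)
    qed
    have "inj_on f (pverts \<Gamma> \<times> {s})"
      by (rule inj_on_subset[OF bij_betw_imp_inj_on[OF f_bij]]) (use s in auto)
    then show "card (f ` (pverts \<Gamma> \<times> {s})) = card (pverts \<Gamma> \<times> {t s})"
      by (simp add: card_image card_cartesian_product)
  qed
  have "(\<lambda>B. f ` B) ` snd_partition \<Gamma> \<Sigma> = snd_partition \<Gamma> \<Sigma>"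
  proof
    show "(\<lambda>B. f ` B) ` snd_partition \<Gamma> \<Sigma> \<subseteq> snd_partition \<Gamma> \<Sigma>"
      unfolding snd_partition_def using image t_in by blast
    show "snd_partition \<Gamma> \<Sigma> \<subseteq> (\<lambda>B. f ` B) ` snd_partition \<Gamma> \<Sigma>"
    proof
      fix B assume "B \<in> snd_partition \<Gamma> \<Sigma>"
      then obtain s where s: "B = pverts \<Gamma> \<times> {s}" "s \<in> pverts \<Sigma>" unfolding snd_partition_def by blast
      \<comment> \<open>Surjectivity of \<open>f\<close> passes to \<open>t\<close>, so every block
        is the image of a block.\<close>
      have "(u, s) \<in> f ` (pverts \<Gamma> \<times> pverts \<Sigma>)" using f_bij u s unfolding bij_betw_def by blast
      then obtain v r where vr: "v \<in> pverts \<Gamma>" "r \<in> pverts \<Sigma>" "f (v, r) = (u, s)" by auto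
      have "t r = s" using indep[OF u vr(1,2)] vr(3) unfolding t_def by simp
      then have "B = f ` (pverts \<Gamma> \<times> {r})" using image[OF vr(2)] s(1) by simp
      then show "B \<in> (\<lambda>B. f ` B) ` snd_partition \<Gamma> \<Sigma>" unfolding snd_partition_def using vr(2) by blast
    qed
  qed
  then show False using mixer unfolding mixer_def by blast
qed

end
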